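(* The Fourier transform $\mathcal F:L^2(\Gamma)\to L^2(\widehat\Gamma)$ is a unitary transformation intertwining $\pi:G\to B(L^2(\Gamma))$ and $\pi^{\circ}\circ\iota:G\to B(L^2(\widehat\Gamma))$, and also intertwining their lifts: for all $g\in G$ and $z\in\mathbb T$, $$\mathcal F\,\pi(g)=(\pi^{\circ}\circ\iota)(g)\,\mathcal F,\qquad \mathcal F\,\widetilde{\pi}(g,z)=\widetilde{\pi^{\circ}\circ\iota}(g,z)\,\mathcal F=\widetilde{\pi}\big(r(g,z)\big)\,\mathcal F .$$
   Context: All abelian groups are written additively. $\Gamma$ is a second countable locally compact abelian group with a fixed Haar measure, $\widehat\Gamma$ is its Pontryagin dual (characters $\gamma:\Gamma\to\mathbb T$, $(\gamma_1+\gamma_2)(s)=\gamma_1(s)\gamma_2(s)$) with the Haar measure for which Plancherel's theorem holds; $\mathcal F(f)(\gamma)=\widehat f(\gamma)=\int_\Gamma f(s)\overline{\gamma(s)}\,ds$, extended to $L^2$. $G=\widehat\Gamma\times\Gamma$ and $\widehat G=\Gamma\times\widehat\Gamma$. A 2-cocycle on a group is a $\mathbb T$-valued function $\omega$ with $\omega(s,t)\omega(s+t,u)=\omega(s,t+u)\omega(t,u)$ and $\omega(0,s)=\omega(s,0)=1$. On $G$ put $\sigma((\gamma_1,t_1),(\gamma_2,t_2))=\overline{\gamma_2(t_1)}$; on $\widehat G$ put $\sigma'((t_1,\gamma_1),(t_2,\gamma_2))=\overline{\gamma_1(t_2)}$. On $L^2(\Gamma)$: $T_t\xi(s)=\xi(s-t)$,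 $M_\gamma\xi(s)=\gamma(s)\xi(s)$, and $\pi(\gamma,t)=M_\gamma T_t$ for $(\gamma,t)\in G$, which is a $\sigma$-projective representation of $G$. On $L^2(\widehat\Gamma)$: $T_\gamma\xi(\delta)=\xi(\delta-\gamma)$, $M_t\xi(\delta)=\delta(t)\xi(\delta)$; for $(t,\gamma)\in\widehat G$, $\pi(t,\gamma)=M_tT_\gamma$ (a $\sigma'$-projective representation of $\widehat G$, denoted by the same letter $\pi$) and $\pi^\circ(t,\gamma)=T_\gamma M_t$. The map $\iota:G\to\widehat G$ is $\iota(\gamma,t)=(-t,\gamma)$, so $(\pi^\circ\circ\iota)(\gamma,t)=T_\gamma M_{-t}$, which is a $\sigma$-projective representation of $G$. For a 2-cocycle $\omega$ on a group $H$, $H\times_\omega\mathbb T$ is $H\times\mathbb T$ with product $(g_1,z_1)(g_2,z_2)=(g_1+g_2,\omega(g_1,g_2)z_1z_2)$, and the lift of an $\omega$-projective representation $\rho$ is $\widetilde\rho(g,z)=z\rho(g)$. In the expression $\widetilde\pi(r(g,z))$, $\widetilde\pi$ is the lift to $\widehat G\times_{\sigma'}\mathbb T$ of $\pi(t,\gamma)=M_tT_\gamma$ on $L^2(\widehat\Gamma)$, and $r:G\times_\sigma\mathbb T\to\widehat G\times_{\sigma'}\mathbb T$ is the isomorphism $r(\gamma,t,z)=(-t,\gamma,\gamma(t)z)$. *)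

theory Defs
  imports "HOL-Analysis.Analysis" "HOL-Algebra.Group"
begin

section \<open>The Pontryagin dual\<close>

typedef (overloaded) ('a::topological_ab_group_add) pdual =
  "{\<gamma> :: 'a \<Rightarrow> complex. continuous_on UNIV \<gamma> \<and> (\<forall>s. cmod (\<gamma> s) = 1) \<and>
      (\<forall>s t. \<gamma> (s + t) = \<gamma> s * \<gamma> t)}"
  morphisms ch Abs_pdual
  by (rule exI[of _ "\<lambda>_. 1"]) auto

setup_lifting type_definition_pdual

lemma pdual_eqI: "(\<And>s. ch \<gamma> s = ch \<delta> s) \<Longrightarrow> \<gamma> = \<delta>"
  by (rule ch_inject[THEN iffD1]) (rule ext)

lemma continuous_on_ch: "continuous_on S (ch \<gamma>)"
  using ch[of \<gamma>] by (auto intro: continuous_on_subset)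

lemma norm_ch [simp]: "cmod (ch \<gamma> s) = 1"
  using ch[of \<gamma>] by auto

lemma ch_add: "ch \<gamma> (s + t) = ch \<gamma> s * ch \<gamma> t"
  using ch[of \<gamma>] by auto

lemma ch_nonzero [simp]: "ch \<gamma> s \<noteq> 0"
  by (metis norm_ch norm_zero zero_neq_one)

lemma ch_0 [simp]: "ch \<gamma> 0 = 1"
  by (metis ch_add ch_nonzero add_0 mult_cancel_right2)

lemma ch_cnj_right [simp]: "ch \<gamma> s * cnj (ch \<gamma> s) = 1"
  by (simp flip: complex_norm_square)

lemma ch_cnj_left [simp]: "cnj (ch \<gamma> s) * ch \<gamma> s = 1"
  by (metis ch_cnj_right mult.commute)

lemma ch_uminus: "ch \<gamma> (- s) = cnj (ch \<gamma> s)"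
proof -
  have "ch \<gamma> (- s) = ch \<gamma> (- s) * (ch \<gamma> s * cnj (ch \<gamma> s))" by simp
  also have "\<dots> = (ch \<gamma> (- s) * ch \<gamma> s) * cnj (ch \<gamma> s)" by (simp only: mult.assoc)
  also have "ch \<gamma> (- s) * ch \<gamma> s = 1" by (simp add: ch_add[symmetric])
  finally show ?thesis by simp
qed

lemma ch_diff: "ch \<gamma> (s - t) = ch \<gamma> s * cnj (ch \<gamma> t)"
  using ch_add[of \<gamma> s "- t"] by (simp add: ch_uminus)

instantiation pdual :: (topological_ab_group_add) ab_group_add
begin

lift_definition zero_pdual :: "'a pdual" is "\<lambda>_. 1"
  by simp

lift_definition plus_pdual :: "'a pdual \<Rightarrow> 'a pdual \<Rightarrow> 'a pdual" is
  "\<lambda>\<gamma> \<delta> s. \<gamma> s * \<delta> s"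
  by (simp add: norm_mult continuous_on_mult)

lift_definition uminus_pdual :: "'a pdual \<Rightarrow> 'a pdual" is "\<lambda>\<gamma> s. cnj (\<gamma> s)"
  by (simp add: continuous_on_cnj)

definition minus_pdual :: "'a pdual \<Rightarrow> 'a pdual \<Rightarrow> 'a pdual" where
  "minus_pdual \<gamma> \<delta> = \<gamma> + (- \<delta>)"

instance
proof
  fix \<gamma> \<delta> \<epsilon> :: "'a pdual"
  show "\<gamma> + \<delta> + \<epsilon> = \<gamma> + (\<delta> + \<epsilon>)"
    by (rule pdual_eqI) (simp add: plus_pdual.rep_eq mult.assoc)
  show "\<gamma> + \<delta> = \<delta> + \<gamma>"
    by (rule pdual_eqI) (simp add: plus_pdual.rep_eq mult.commute)
  show "0 + \<gamma> = \<gamma>"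
    by (rule pdual_eqI) (simp add: plus_pdual.rep_eq zero_pdual.rep_eq)
  show "- \<gamma> + \<gamma> = 0"
    by (rule pdual_eqI) (simp add: plus_pdual.rep_eq uminus_pdual.rep_eq zero_pdual.rep_eq)
  show "\<gamma> - \<delta> = \<gamma> + (- \<delta>)" by (rule minus_pdual_def)
qed

end

lemma ch_zero_apply [simp]: "ch 0 s = 1"
  by (simp add: zero_pdual.rep_eq)

lemma ch_plus_apply: "ch (\<gamma> + \<delta>) s = ch \<gamma> s * ch \<delta> s"
  by (simp add: plus_pdual.rep_eq)

lemma ch_uminus_apply: "ch (- \<gamma>) s = cnj (ch \<gamma> s)"
  by (simp add: uminus_pdual.rep_eq)

lemma ch_diff_apply: "ch (\<gamma> - \<delta>) s = ch \<gamma> s * cnj (ch \<delta> s)"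
  unfolding minus_pdual_def by (simp only: ch_plus_apply ch_uminus_apply)

text \<open>The dual carries the compact-open topology.\<close>

instantiation pdual :: (topological_ab_group_add) topological_space
begin

definition open_pdual :: "'a pdual set \<Rightarrow> bool" where
  "open_pdual = generate_topology
     {{\<gamma>. ch \<gamma> ` K \<subseteq> U} |K U. compact K \<and> open U}"

instance
proof
  note [simp] = open_pdual_def
  show "open (UNIV :: 'a pdual set)" by (simp add: generate_topology.UNIV)
  show "open (S \<inter> T)" if "open S" "open T" for S T :: "'a pdual set"
    using that by (simp add: generate_topology.Int)
  show "open (\<Union>K)" if "\<forall>S\<in>K. open S" for K :: "'a pdual set set"
    using that by (auto intro: generate_topology.UN)
qed

end

lemma open_pdual_basic: "compact K \<Longrightarrow> open U \<Longrightarrow> open {\<gamma>. ch \<gamma> ` K \<subseteq> U}"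
  unfolding open_pdual_def by (rule generate_topology.Basis) blast

lemma eventually_nhds_pdual:
  assumes K: "compact K" and e: "e > 0"
  shows "\<forall>\<^sub>F \<delta> in nhds \<gamma>. \<forall>s\<in>K. dist (ch \<delta> s) (ch \<gamma> s) < e"
proof -
  have "compact (ch \<gamma> ` K)"
    by (rule compact_continuous_image[OF continuous_on_ch K])
  then obtain C where C: "C \<subseteq> ch \<gamma> ` K" "finite C" "ch \<gamma> ` K \<subseteq> (\<Union>c\<in>C. ball c (e/4))"
    using e by (elim compactE_image[where f = "\<lambda>c. ball c (e/4)" and C = "ch \<gamma> ` K"]) auto
  define L where "L c = K \<inter> ch \<gamma> -` cball c (e/4)" for c
  have L: "compact (L c)" for c
    unfolding L_def
    by (intro compact_Int_closed K closed_vimage closed_cball continuous_on_ch)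
  let ?N = "\<Inter>c\<in>C. {\<delta>. ch \<delta> ` L c \<subseteq> ball c (e/2)}"
  have "open ?N"
    by (intro open_INT ballI open_pdual_basic L C) auto
  moreover have "\<gamma> \<in> ?N"
    using e by (auto simp: L_def)
  moreover have "dist (ch \<delta> s) (ch \<gamma> s) < e" if "\<delta> \<in> ?N" "s \<in> K" for \<delta> s
  proof -
    from C that(2) obtain c where c: "c \<in> C" "dist c (ch \<gamma> s) < e/4" by auto
    then have "s \<in> L c" using that(2) by (auto simp: L_def)
    then have "ch \<delta> s \<in> ball c (e/2)" using that(1) c(1) by blast
    then have "dist c (ch \<delta> s) < e/2" by simp
    with c(2) e show ?thesis
      using dist_triangle3[of "ch \<delta> s" "ch \<gamma> s" c] by linarith
  qed
  ultimately show ?thesis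
    unfolding eventually_nhds by (intro exI[of _ ?N] conjI ballI) assumption+
qed

lemma tendsto_pdualI:
  fixes f :: "'b \<Rightarrow> 'a::topological_ab_group_add pdual"
  assumes "\<And>K e. compact K \<Longrightarrow> e > 0 \<Longrightarrow> \<forall>\<^sub>F x in F. \<forall>s\<in>K. dist (ch (f x) s) (ch \<gamma> s) < e"
  shows "(f \<longlongrightarrow> \<gamma>) F"
proof -
  have "\<forall>\<^sub>F x in F. ch (f x) ` K \<subseteq> U"
    if KU: "compact K" "open U" "ch \<gamma> ` K \<subseteq> U" for K and U :: "complex set"
  proof -
    obtain e where e: "e > 0" "(\<Union>c\<in>ch \<gamma> ` K. ball c e) \<subseteq> U"
      by (rule compact_subset_open_imp_ball_epsilon_subset[OF
            compact_continuous_image[OF continuous_on_ch KU(1)] KU(2,3)])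
    from assms[OF KU(1) e(1)] show ?thesis
      by eventually_elim (use e(2) in \<open>fastforce simp: dist_commute\<close>)
  qed
  then show ?thesis
    unfolding nhds_generated_topology[OF open_pdual_def] filterlim_INF filterlim_principal
    by auto
qed

instance pdual :: (topological_ab_group_add) topological_ab_group_add
proof
  fix \<gamma> \<delta> :: "'a pdual"
  show "((\<lambda>x. fst x + snd x) \<longlongrightarrow> \<gamma> + \<delta>) (nhds \<gamma> \<times>\<^sub>F nhds \<delta>)"
  proof (rule tendsto_pdualI)
    fix K :: "'a set" and e :: real
    assume K: "compact K" and e: "e > 0"
    from e have e2: "e / 2 > 0" by simp
    have "\<forall>\<^sub>F x in nhds \<gamma> \<times>\<^sub>F nhds \<delta>. (\<forall>s\<in>K. dist (ch (fst x) s) (ch \<gamma> s) < e/2) \<and>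
            (\<forall>s\<in>K. dist (ch (snd x) s) (ch \<delta> s) < e/2)"
      using eventually_compose_filterlim[OF eventually_nhds_pdual[OF K e2, of \<gamma>] filterlim_fst]
        eventually_compose_filterlim[OF eventually_nhds_pdual[OF K e2, of \<delta>] filterlim_snd]
      by (rule eventually_conj)
    then show "\<forall>\<^sub>F x in nhds \<gamma> \<times>\<^sub>F nhds \<delta>. \<forall>s\<in>K. dist (ch (fst x + snd x) s) (ch (\<gamma> + \<delta>) s) < e"
    proof eventually_elim
      case (elim x)
      show ?case
      proof
        fix s assume s: "s \<in> K"
        have "ch (fst x + snd x) s - ch (\<gamma> + \<delta>) s =
            (ch (fst x) s - ch \<gamma> s) * ch (snd x) s + ch \<gamma> s * (ch (snd x) s - ch \<delta> s)"
          by (simp add: ch_plus_apply algebra_simps)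
        also have "cmod \<dots> \<le> cmod (ch (fst x) s - ch \<gamma> s) + cmod (ch (snd x) s - ch \<delta> s)"
          by (rule order_trans[OF norm_triangle_ineq]) (simp add: norm_mult)
        also have "\<dots> < e"
          using elim s by (force simp: dist_norm)
        finally show "dist (ch (fst x + snd x) s) (ch (\<gamma> + \<delta>) s) < e"
          by (simp add: dist_norm)
      qed
    qed
  qed
  show "(uminus \<longlongrightarrow> - \<gamma>) (nhds \<gamma>)"
  proof (rule tendsto_pdualI)
    fix K :: "'a set" and e :: real
    assume K: "compact K" and e: "e > 0"
    have "dist (ch (- \<beta>) s) (ch (- \<gamma>) s) = dist (ch \<beta> s) (ch \<gamma> s)" for \<beta> s
      by (simp add: ch_uminus_apply dist_norm flip: complex_cnj_diff)
    then show "\<forall>\<^sub>F \<beta> in nhds \<gamma>. \<forall>s\<in>K. dist (ch (- \<beta>) s) (ch (- \<gamma>) s) < e"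
      using eventually_nhds_pdual[OF K e, of \<gamma>] by simp
  qed
qed

instance pdual :: (topological_ab_group_add) t2_space
proof
  fix \<gamma> \<delta> :: "'a pdual"
  assume "\<gamma> \<noteq> \<delta>"
  then obtain s where "ch \<gamma> s \<noteq> ch \<delta> s" using pdual_eqI by blast
  then obtain U V where UV: "open U" "open V" "ch \<gamma> s \<in> U" "ch \<delta> s \<in> V" "U \<inter> V = {}"
    by (metis hausdorff)
  let ?W = "\<lambda>U. {\<gamma>. ch \<gamma> ` {s} \<subseteq> U}"
  show "\<exists>U V. open U \<and> open V \<and> \<gamma> \<in> U \<and> \<delta> \<in> V \<and> U \<inter> V = {}"
    by (rule exI[of _ "?W U"], rule exI[of _ "?W V"])
       (use UV in \<open>auto intro!: open_pdual_basic simp del: image_insert image_empty\<close>)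
qed

section \<open>Haar measures\<close>

definition haar_measure :: "'g::topological_ab_group_add measure \<Rightarrow> bool" where
  "haar_measure \<mu> \<longleftrightarrow>
     sets \<mu> = sets borel \<and>
     emeasure \<mu> UNIV \<noteq> 0 \<and>
     (\<forall>K. compact K \<longrightarrow> emeasure \<mu> K < \<infinity>) \<and>
     (\<forall>A\<in>sets borel. emeasure \<mu> A = (INF U\<in>{U. open U \<and> A \<subseteq> U}. emeasure \<mu> U)) \<and>
     (\<forall>U. open U \<longrightarrow> emeasure \<mu> U = (SUP K\<in>{K. compact K \<and> K \<subseteq> U}. emeasure \<mu> K)) \<and>
     (\<forall>A\<in>sets borel. \<forall>t. emeasure \<mu> ((+) t ` A) = emeasure \<mu> A)"

section \<open>The Hilbert space of square-integrable functions\<close>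

definition L2_fun :: "'a measure \<Rightarrow> ('a \<Rightarrow> complex) set" where
  "L2_fun M = {f \<in> borel_measurable M. integrable M (\<lambda>x. (cmod (f x))\<^sup>2)}"

definition L2_class :: "'a measure \<Rightarrow> ('a \<Rightarrow> complex) \<Rightarrow> ('a \<Rightarrow> complex) set" where
  "L2_class M f = {g \<in> L2_fun M. AE x in M. g x = f x}"

definition L2 :: "'a measure \<Rightarrow> ('a \<Rightarrow> complex) set set" where
  "L2 M = L2_class M ` L2_fun M"

text \<open>The operations on \<^term>\<open>L2 M\<close> are defined on representatives; on elements of
  \<^term>\<open>L2 M\<close> all members of the unions below coincide whenever the operation on functions
  respects almost-everywhere equality.\<close>

definition L2_map :: "'a measure \<Rightarrow> (('a \<Rightarrow> complex) \<Rightarrow> 'a \<Rightarrow> complex) \<Rightarrow>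
    ('a \<Rightarrow> complex) set \<Rightarrow> ('a \<Rightarrow> complex) set" where
  "L2_map M \<phi> X = (\<Union>f\<in>X. L2_class M (\<phi> f))"

definition L2_scale :: "'a measure \<Rightarrow> complex \<Rightarrow> ('a \<Rightarrow> complex) set \<Rightarrow> ('a \<Rightarrow> complex) set" where
  "L2_scale M c = L2_map M (\<lambda>f x. c * f x)"

definition L2_add :: "'a measure \<Rightarrow> ('a \<Rightarrow> complex) set \<Rightarrow> ('a \<Rightarrow> complex) set \<Rightarrow>
    ('a \<Rightarrow> complex) set" where
  "L2_add M X Y = (\<Union>f\<in>X. \<Union>g\<in>Y. L2_class M (\<lambda>x. f x + g x))"

definition L2_inner :: "'a measure \<Rightarrow> ('a \<Rightarrow> complex) set \<Rightarrow> ('a \<Rightarrow> complex) set \<Rightarrow> complex" where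
  "L2_inner M X Y = the_elem (\<Union>f\<in>X. \<Union>g\<in>Y. {LINT x|M. f x * cnj (g x)})"

definition L2_norm :: "'a measure \<Rightarrow> ('a \<Rightarrow> complex) set \<Rightarrow> real" where
  "L2_norm M X = sqrt (Re (L2_inner M X X))"

definition L2_dist :: "'a measure \<Rightarrow> ('a \<Rightarrow> complex) set \<Rightarrow> ('a \<Rightarrow> complex) set \<Rightarrow> real" where
  "L2_dist M X Y = L2_norm M (L2_add M X (L2_scale M (-1) Y))"

definition L2_unitary :: "'a measure \<Rightarrow> 'b measure \<Rightarrow>
    (('a \<Rightarrow> complex) set \<Rightarrow> ('b \<Rightarrow> complex) set) \<Rightarrow> bool" where
  "L2_unitary M N U \<longleftrightarrow>
     bij_betw U (L2 M) (L2 N) \<and>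
     (\<forall>X\<in>L2 M. \<forall>Y\<in>L2 M. U (L2_add M X Y) = L2_add N (U X) (U Y)) \<and>
     (\<forall>c. \<forall>X\<in>L2 M. U (L2_scale M c X) = L2_scale N c (U X)) \<and>
     (\<forall>X\<in>L2 M. \<forall>Y\<in>L2 M. L2_inner N (U X) (U Y) = L2_inner M X Y)"

section \<open>The Fourier transform\<close>

definition fourier :: "'a::topological_ab_group_add measure \<Rightarrow> ('a \<Rightarrow> complex) \<Rightarrow>
    'a pdual \<Rightarrow> complex" where
  "fourier \<mu> f \<gamma> = (LINT s|\<mu>. f s * cnj (ch \<gamma> s))"

definition L1_L2_fun :: "'a measure \<Rightarrow> ('a \<Rightarrow> complex) set" where
  "L1_L2_fun M = {f. integrable M f} \<inter> L2_fun M"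

text \<open>The normalisation of the Haar measure on the dual: the Plancherel identity on
  the integrable square-integrable functions. Only this identity is required; that the
  extension of the transform is onto is not part of the definition.\<close>

definition plancherel_measure :: "'a::topological_ab_group_add measure \<Rightarrow> 'a pdual measure \<Rightarrow> bool"
  where
  "plancherel_measure \<mu> \<nu> \<longleftrightarrow>
     haar_measure \<nu> \<and>
     (\<forall>f\<in>L1_L2_fun \<mu>. fourier \<mu> f \<in> L2_fun \<nu> \<and>
        (LINT \<gamma>|\<nu>. (cmod (fourier \<mu> f \<gamma>))\<^sup>2) = (LINT s|\<mu>. (cmod (f s))\<^sup>2))"

text \<open>Extension by continuity: the transform of \<^term>\<open>X\<close> is the limit of the transforms of
  integrable functions converging to \<^term>\<open>X\<close>.\<close>

definition L2_fourier :: "'a::topological_ab_group_add measure \<Rightarrow> 'a pdual measure \<Rightarrow>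
    ('a \<Rightarrow> complex) set \<Rightarrow> ('a pdual \<Rightarrow> complex) set" where
  "L2_fourier \<mu> \<nu> X = (THE Y. Y \<in> L2 \<nu> \<and>
     (\<exists>f. (\<forall>n::nat. f n \<in> L1_L2_fun \<mu>) \<and>
        (\<lambda>n. L2_dist \<mu> (L2_class \<mu> (f n)) X) \<longlonglongrightarrow> 0 \<and>
        (\<lambda>n. L2_dist \<nu> (L2_class \<nu> (fourier \<mu> (f n))) Y) \<longlonglongrightarrow> 0))"

section \<open>Cocycles, twisted products and lifts\<close>

definition cocycle :: "('g::ab_group_add \<Rightarrow> 'g \<Rightarrow> complex) \<Rightarrow> bool" where
  "cocycle \<omega> \<longleftrightarrow>
     (\<forall>s t. cmod (\<omega> s t) = 1) \<and>
     (\<forall>s t u. \<omega> s t * \<omega> (s + t) u = \<omega> s (t + u) * \<omega> t u) \<and>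
     (\<forall>s. \<omega> 0 s = 1 \<and> \<omega> s 0 = 1)"

definition twisted_product :: "('g::ab_group_add \<Rightarrow> 'g \<Rightarrow> complex) \<Rightarrow> ('g \<times> complex) monoid" where
  "twisted_product \<omega> =
     \<lparr>carrier = UNIV \<times> sphere 0 1,
      mult = (\<lambda>(g1, z1) (g2, z2). (g1 + g2, \<omega> g1 g2 * z1 * z2)),
      one = (0, 1)\<rparr>"

definition lift_rep :: "'a measure \<Rightarrow> ('g \<Rightarrow> ('a \<Rightarrow> complex) set \<Rightarrow> ('a \<Rightarrow> complex) set) \<Rightarrow>
    'g \<times> complex \<Rightarrow> ('a \<Rightarrow> complex) set \<Rightarrow> ('a \<Rightarrow> complex) set" where
  "lift_rep M \<rho> = (\<lambda>(g, z) X. L2_scale M z (\<rho> g X))"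

definition \<sigma> :: "'a::topological_ab_group_add pdual \<times> 'a \<Rightarrow> 'a pdual \<times> 'a \<Rightarrow> complex" where
  "\<sigma> = (\<lambda>(\<gamma>1, t1) (\<gamma>2, t2). cnj (ch \<gamma>2 t1))"

definition \<sigma>' :: "'a::topological_ab_group_add \<times> 'a pdual \<Rightarrow> 'a \<times> 'a pdual \<Rightarrow> complex" where
  "\<sigma>' = (\<lambda>(t1, \<gamma>1) (t2, \<gamma>2). cnj (ch \<gamma>1 t2))"

definition \<iota> :: "'a::topological_ab_group_add pdual \<times> 'a \<Rightarrow> 'a \<times> 'a pdual" where
  "\<iota> = (\<lambda>(\<gamma>, t). (- t, \<gamma>))"

definition r_map :: "('a::topological_ab_group_add pdual \<times> 'a) \<times> complex \<Rightarrow> ('a \<times> 'a pdual) \<times> complex"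
  where "r_map = (\<lambda>((\<gamma>, t), z). ((- t, \<gamma>), ch \<gamma> t * z))"

lemma cocycle_\<sigma>: "cocycle \<sigma>"
  by (auto simp: cocycle_def \<sigma>_def split_def ch_add ch_plus_apply)

lemma cocycle_\<sigma>': "cocycle \<sigma>'"
  by (auto simp: cocycle_def \<sigma>'_def split_def ch_add ch_plus_apply)

lemma group_twisted_product:
  assumes "cocycle \<omega>"
  shows "group (twisted_product \<omega>)"
proof (rule groupI)
  have 1: "cmod (\<omega> s t) = 1" "\<omega> 0 s = 1" "\<omega> s 0 = 1"
    and 2: "\<omega> s t * \<omega> (s + t) u = \<omega> s (t + u) * \<omega> t u" for s t u
    using assms by (auto simp: cocycle_def)
  note [simp] = twisted_product_def 1
  fix x y z
  assume x: "x \<in> carrier (twisted_product \<omega>)"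
  obtain a b where ab: "x = (a, b)" by force
  have "(- a, inverse (\<omega> (- a) a * b)) \<in> carrier (twisted_product \<omega>)"
    using x ab by (simp add: norm_inverse norm_mult)
  moreover have "b \<noteq> 0" "\<omega> (- a) a \<noteq> 0"
    using x ab 1(1)[of "- a" a] by fastforce+
  then have "(- a, inverse (\<omega> (- a) a * b)) \<otimes>\<^bsub>twisted_product \<omega>\<^esub> x = \<one>\<^bsub>twisted_product \<omega>\<^esub>"
    using ab by (simp add: field_simps)
  ultimately show "\<exists>y\<in>carrier (twisted_product \<omega>). y \<otimes>\<^bsub>twisted_product \<omega>\<^esub> x = \<one>\<^bsub>twisted_product \<omega>\<^esub>"
    by blast
  assume y: "y \<in> carrier (twisted_product \<omega>)"
  show "x \<otimes>\<^bsub>twisted_product \<omega>\<^esub> y \<in> carrier (twisted_product \<omega>)"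
    using x y by (auto simp: norm_mult)
  show "x \<otimes>\<^bsub>twisted_product \<omega>\<^esub> y \<otimes>\<^bsub>twisted_product \<omega>\<^esub> z =
        x \<otimes>\<^bsub>twisted_product \<omega>\<^esub> (y \<otimes>\<^bsub>twisted_product \<omega>\<^esub> z)"
    using 2 by (auto simp: split_def algebra_simps)
qed (auto simp: twisted_product_def assms[unfolded cocycle_def])

lemma r_map_iso: "r_map \<in> iso (twisted_product \<sigma>) (twisted_product \<sigma>')"
proof -
  have "bij_betw r_map (UNIV \<times> sphere 0 1) (UNIV \<times> sphere (0::complex) 1)"
    by (rule bij_betw_byWitness[where f' = "\<lambda>((t, \<gamma>), z). ((\<gamma>, - t), ch \<gamma> t * z)"])
       (auto simp: r_map_def norm_mult ch_uminus mult.assoc[symmetric])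
  moreover have "r_map \<in> hom (twisted_product \<sigma>) (twisted_product \<sigma>')"
    by (auto simp: hom_def twisted_product_def r_map_def \<sigma>_def \<sigma>'_def norm_mult ch_uminus ch_add
        ch_plus_apply)
  ultimately show ?thesis
    by (simp add: iso_def twisted_product_def)
qed

section \<open>Time-frequency shifts\<close>

text \<open>The translation and multiplication operators are used both on the group and on its dual.
  The character of the dual group defined by an element \<open>t\<close> is \<open>\<lambda>\<delta>. ch \<delta> t\<close>.\<close>

definition L2_translate :: "'g::ab_group_add measure \<Rightarrow> 'g \<Rightarrow>
    ('g \<Rightarrow> complex) set \<Rightarrow> ('g \<Rightarrow> complex) set" where
  "L2_translate M t = L2_map M (\<lambda>\<xi> s. \<xi> (s - t))"

definition L2_modulate :: "'g measure \<Rightarrow> ('g \<Rightarrow> complex) \<Rightarrow>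
    ('g \<Rightarrow> complex) set \<Rightarrow> ('g \<Rightarrow> complex) set" where
  "L2_modulate M u = L2_map M (\<lambda>\<xi> s. u s * \<xi> s)"

definition \<pi> :: "'a::topological_ab_group_add measure \<Rightarrow> 'a pdual \<times> 'a \<Rightarrow>
    ('a \<Rightarrow> complex) set \<Rightarrow> ('a \<Rightarrow> complex) set" where
  "\<pi> \<mu> = (\<lambda>(\<gamma>, t). L2_modulate \<mu> (ch \<gamma>) \<circ> L2_translate \<mu> t)"

definition \<pi>' :: "'a::topological_ab_group_add pdual measure \<Rightarrow> 'a \<times> 'a pdual \<Rightarrow>
    ('a pdual \<Rightarrow> complex) set \<Rightarrow> ('a pdual \<Rightarrow> complex) set" where
  "\<pi>' \<nu> = (\<lambda>(t, \<gamma>). L2_modulate \<nu> (\<lambda>\<delta>. ch \<delta> t) \<circ> L2_translate \<nu> \<gamma>)"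

definition \<pi>_op :: "'a::topological_ab_group_add pdual measure \<Rightarrow> 'a \<times> 'a pdual \<Rightarrow>
    ('a pdual \<Rightarrow> complex) set \<Rightarrow> ('a pdual \<Rightarrow> complex) set" where
  "\<pi>_op \<nu> = (\<lambda>(t, \<gamma>). L2_translate \<nu> \<gamma> \<circ> L2_modulate \<nu> (\<lambda>\<delta>. ch \<delta> t))"

lemma continuous_on_ch_eval: "continuous_on S (\<lambda>\<delta>. ch \<delta> t)"
proof -
  have "((\<lambda>\<delta>. ch \<delta> t) \<longlongrightarrow> ch \<gamma> t) (at \<gamma>)" for \<gamma>
  proof (rule tendstoI)
    fix e :: real assume "e > 0"
    then show "\<forall>\<^sub>F \<delta> in at \<gamma>. dist (ch \<delta> t) (ch \<gamma> t) < e"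
      using eventually_nhds_pdual[of "{t}" e \<gamma>]
      by (auto simp: eventually_at_filter elim: eventually_mono)
  qed
  then show ?thesis
    by (simp add: continuous_at_imp_continuous_on isCont_def)
qed

lemma L2_classI: "f \<in> L2_fun M \<Longrightarrow> f \<in> L2_class M f"
  by (simp add: L2_class_def)

lemma L2_class_cong:
  assumes "AE x in M. f x = g x"
  shows "L2_class M f = L2_class M g"
proof -
  have "(AE x in M. h x = f x) \<longleftrightarrow> (AE x in M. h x = g x)" for h
    using assms by (auto elim: AE_mp)
  then show ?thesis by (simp add: L2_class_def)
qed

lemma L2_map_class:
  assumes f: "f \<in> L2_fun M"
    and cong: "\<And>g. g \<in> L2_fun M \<Longrightarrow> AE x in M. g x = f x \<Longrightarrow> AE x in M. \<phi> g x = \<phi> f x"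
  shows "L2_map M \<phi> (L2_class M f) = L2_class M (\<phi> f)"
proof -
  have "L2_class M (\<phi> g) = L2_class M (\<phi> f)" if "g \<in> L2_class M f" for g
    using that by (intro L2_class_cong cong) (auto simp: L2_class_def)
  then show ?thesis
    using L2_classI[OF f] unfolding L2_map_def by blast
qed

lemma L2_scale_class:
  "f \<in> L2_fun M \<Longrightarrow> L2_scale M c (L2_class M f) = L2_class M (\<lambda>x. c * f x)"
  unfolding L2_scale_def by (rule L2_map_class) (auto elim: AE_mp)

lemma L2_modulate_fun:
  assumes "f \<in> L2_fun M" "u \<in> borel_measurable M" "\<And>x. cmod (u x) = 1"
  shows "(\<lambda>x. u x * f x) \<in> L2_fun M"
  using assms by (auto simp: L2_fun_def norm_mult)

lemma L2_modulate_class: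
  "f \<in> L2_fun M \<Longrightarrow> L2_modulate M u (L2_class M f) = L2_class M (\<lambda>x. u x * f x)"
  unfolding L2_modulate_def by (rule L2_map_class) (auto elim: AE_mp)

lemma haar_distr_shift:
  assumes "haar_measure \<mu>"
  shows "distr \<mu> \<mu> (\<lambda>s. s - t) = \<mu>" and "(\<lambda>s. s - t) \<in> measurable \<mu> \<mu>"
proof -
  have sets: "sets \<mu> = sets borel"
    and inv: "A \<in> sets borel \<Longrightarrow> emeasure \<mu> ((+) t ` A) = emeasure \<mu> A" for A
    using assms by (auto simp: haar_measure_def)
  have space: "space \<mu> = UNIV" using sets_eq_imp_space_eq[OF sets] by simp
  have "(\<lambda>s. s - t) \<in> measurable borel borel"
    by (intro borel_measurable_continuous_onI continuous_intros)
  then show meas: "(\<lambda>s. s - t) \<in> measurable \<mu> \<mu>"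
    by (simp add: measurable_cong_sets[OF sets sets])
  show "distr \<mu> \<mu> (\<lambda>s. s - t) = \<mu>"
  proof (rule measure_eqI)
    fix A assume "A \<in> sets (distr \<mu> \<mu> (\<lambda>s. s - t))"
    then have A: "A \<in> sets \<mu>" by simp
    have "(\<lambda>s. s - t) -` A \<inter> space \<mu> = (+) t ` A"
    proof (intro equalityI subsetI)
      fix x assume "x \<in> (\<lambda>s. s - t) -` A \<inter> space \<mu>"
      then show "x \<in> (+) t ` A" by (intro image_eqI[of _ _ "x - t"]) auto
    qed (auto simp: space)
    then show "emeasure (distr \<mu> \<mu> (\<lambda>s. s - t)) A = emeasure \<mu> A"
      using A sets by (simp add: emeasure_distr[OF meas] inv)
  qed simp
qed

lemma L2_translate_fun:
  assumes \<mu>: "haar_measure \<mu>" and f: "f \<in> L2_fun \<mu>"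
  shows "(\<lambda>s. f (s - t)) \<in> L2_fun \<mu>"
proof -
  note shift = haar_distr_shift[OF \<mu>, of t]
  have "f \<in> borel_measurable \<mu>" and "integrable (distr \<mu> \<mu> (\<lambda>s. s - t)) (\<lambda>x. (cmod (f x))\<^sup>2)"
    using f unfolding shift(1) by (auto simp: L2_fun_def)
  then show ?thesis
    using measurable_compose[OF shift(2)] integrable_distr[OF shift(2)] by (auto simp: L2_fun_def)
qed

lemma L2_translate_class:
  assumes \<mu>: "haar_measure \<mu>" and f: "f \<in> L2_fun \<mu>"
  shows "L2_translate \<mu> t (L2_class \<mu> f) = L2_class \<mu> (\<lambda>s. f (s - t))"
  unfolding L2_translate_def
proof (rule L2_map_class[OF f])
  fix g assume "AE x in \<mu>. g x = f x"
  then show "AE x in \<mu>. g (x - t) = f (x - t)"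
    using AE_distrD[OF haar_distr_shift(2)[OF \<mu>, of t], of "\<lambda>x. g x = f x",
        unfolded haar_distr_shift(1)[OF \<mu>]] by simp
qed

lemma measurable_ch [simp]:
  assumes "haar_measure \<mu>"
  shows "ch \<gamma> \<in> borel_measurable \<mu>"
proof -
  have "sets \<mu> = sets borel" using assms by (simp add: haar_measure_def)
  from measurable_cong_sets[OF this refl] show ?thesis
    using borel_measurable_continuous_onI[OF continuous_on_ch] by blast
qed

lemma measurable_ch_eval [simp]:
  assumes "haar_measure \<nu>"
  shows "(\<lambda>\<delta>. ch \<delta> t) \<in> borel_measurable \<nu>"
proof -
  have "sets \<nu> = sets borel" using assms by (simp add: haar_measure_def)
  from measurable_cong_sets[OF this refl] show ?thesis
    using borel_measurable_continuous_onI[OF continuous_on_ch_eval] by blast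
qed

lemma \<pi>_class:
  assumes "haar_measure \<mu>" "f \<in> L2_fun \<mu>"
  shows "\<pi> \<mu> (\<gamma>, t) (L2_class \<mu> f) = L2_class \<mu> (\<lambda>s. ch \<gamma> s * f (s - t))"
  using assms by (simp add: \<pi>_def L2_translate_class L2_modulate_class L2_translate_fun)

lemma \<pi>'_class:
  assumes "haar_measure \<nu>" "f \<in> L2_fun \<nu>"
  shows "\<pi>' \<nu> (t, \<gamma>) (L2_class \<nu> f) = L2_class \<nu> (\<lambda>\<delta>. ch \<delta> t * f (\<delta> - \<gamma>))"
  using assms by (simp add: \<pi>'_def L2_translate_class L2_modulate_class L2_translate_fun)

lemma \<pi>_op_class:
  assumes "haar_measure \<nu>" "f \<in> L2_fun \<nu>"
  shows "\<pi>_op \<nu> (t, \<gamma>) (L2_class \<nu> f) = L2_class \<nu> (\<lambda>\<delta>. ch (\<delta> - \<gamma>) t * f (\<delta> - \<gamma>))"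
  using assms by (simp add: \<pi>_op_def L2_translate_class L2_modulate_class L2_modulate_fun)

lemma \<pi>_projective:
  assumes \<mu>: "haar_measure \<mu>" and X: "X \<in> L2 \<mu>"
  shows "\<pi> \<mu> g (\<pi> \<mu> h X) = L2_scale \<mu> (\<sigma> g h) (\<pi> \<mu> (g + h) X)"
proof -
  obtain f where f: "X = L2_class \<mu> f" "f \<in> L2_fun \<mu>" using X by (auto simp: L2_def)
  obtain \<gamma>1 t1 \<gamma>2 t2 where gh: "g = (\<gamma>1, t1)" "h = (\<gamma>2, t2)" by force
  have shf: "(\<lambda>s. ch \<gamma> s * f (s - t)) \<in> L2_fun \<mu>" for \<gamma> t
    using f \<mu> by (intro L2_modulate_fun L2_translate_fun) auto
  have "\<pi> \<mu> g (\<pi> \<mu> h X) = L2_class \<mu> (\<lambda>s. ch \<gamma>1 s * (ch \<gamma>2 (s - t1) * f (s - t1 - t2)))"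
    unfolding f(1) gh by (simp only: \<pi>_class[OF \<mu> f(2)] \<pi>_class[OF \<mu> shf])
  also have "\<dots> = L2_class \<mu> (\<lambda>s. \<sigma> g h * (ch (\<gamma>1 + \<gamma>2) s * f (s - (t1 + t2))))"
    by (intro arg_cong[where f = "L2_class \<mu>"] ext)
       (simp add: gh \<sigma>_def ch_diff ch_plus_apply diff_diff_eq mult_ac)
  also have "\<dots> = L2_scale \<mu> (\<sigma> g h) (\<pi> \<mu> (g + h) X)"
    unfolding f(1) gh by (simp only: add_Pair \<pi>_class[OF \<mu> f(2)] L2_scale_class[OF shf])
  finally show ?thesis .
qed

lemma \<pi>'_projective:
  assumes \<nu>: "haar_measure \<nu>" and X: "X \<in> L2 \<nu>"
  shows "\<pi>' \<nu> g (\<pi>' \<nu> h X) = L2_scale \<nu> (\<sigma>' g h) (\<pi>' \<nu> (g + h) X)"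
proof -
  obtain f where f: "X = L2_class \<nu> f" "f \<in> L2_fun \<nu>" using X by (auto simp: L2_def)
  obtain \<gamma>1 t1 \<gamma>2 t2 where gh: "g = (t1, \<gamma>1)" "h = (t2, \<gamma>2)" by force
  have shf: "(\<lambda>\<delta>. ch \<delta> t * f (\<delta> - \<gamma>)) \<in> L2_fun \<nu>" for \<gamma> t
    using f \<nu> by (intro L2_modulate_fun L2_translate_fun) auto
  have "\<pi>' \<nu> g (\<pi>' \<nu> h X) = L2_class \<nu> (\<lambda>\<delta>. ch \<delta> t1 * (ch (\<delta> - \<gamma>1) t2 * f (\<delta> - \<gamma>1 - \<gamma>2)))"
    unfolding f(1) gh by (simp only: \<pi>'_class[OF \<nu> f(2)] \<pi>'_class[OF \<nu> shf])
  also have "\<dots> = L2_class \<nu> (\<lambda>\<delta>. \<sigma>' g h * (ch \<delta> (t1 + t2) * f (\<delta> - (\<gamma>1 + \<gamma>2))))"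
    by (intro arg_cong[where f = "L2_class \<nu>"] ext)
       (simp add: gh \<sigma>'_def ch_diff_apply ch_add diff_diff_eq mult_ac)
  also have "\<dots> = L2_scale \<nu> (\<sigma>' g h) (\<pi>' \<nu> (g + h) X)"
    unfolding f(1) gh by (simp only: add_Pair \<pi>'_class[OF \<nu> f(2)] L2_scale_class[OF shf])
  finally show ?thesis .
qed

lemma \<pi>_op_\<iota>_projective:
  assumes \<nu>: "haar_measure \<nu>" and X: "X \<in> L2 \<nu>"
  shows "(\<pi>_op \<nu> \<circ> \<iota>) g ((\<pi>_op \<nu> \<circ> \<iota>) h X) = L2_scale \<nu> (\<sigma> g h) ((\<pi>_op \<nu> \<circ> \<iota>) (g + h) X)"
proof -
  obtain f where f: "X = L2_class \<nu> f" "f \<in> L2_fun \<nu>" using X by (auto simp: L2_def)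
  obtain \<gamma>1 t1 \<gamma>2 t2 where gh: "g = (\<gamma>1, t1)" "h = (\<gamma>2, t2)" by force
  have shf: "(\<lambda>\<delta>. ch (\<delta> - \<gamma>) t * f (\<delta> - \<gamma>)) \<in> L2_fun \<nu>" for \<gamma> t
    using L2_translate_fun[OF \<nu> L2_modulate_fun[OF f(2) measurable_ch_eval[OF \<nu>]], of t \<gamma>]
    by simp
  have \<iota>: "(\<pi>_op \<nu> \<circ> \<iota>) (\<gamma>, t) = \<pi>_op \<nu> (- t, \<gamma>)" for \<gamma> t
    by (simp add: \<iota>_def)
  have "(\<pi>_op \<nu> \<circ> \<iota>) g ((\<pi>_op \<nu> \<circ> \<iota>) h X) = L2_class \<nu> (\<lambda>\<delta>. ch (\<delta> - \<gamma>1) (- t1) *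
      (ch (\<delta> - \<gamma>1 - \<gamma>2) (- t2) * f (\<delta> - \<gamma>1 - \<gamma>2)))"
    unfolding f(1) gh by (simp only: \<iota> \<pi>_op_class[OF \<nu> f(2)] \<pi>_op_class[OF \<nu> shf])
  also have "\<dots> = L2_class \<nu> (\<lambda>\<delta>. \<sigma> g h *
      (ch (\<delta> - (\<gamma>1 + \<gamma>2)) (- (t1 + t2)) * f (\<delta> - (\<gamma>1 + \<gamma>2))))"
  proof (intro arg_cong[where f = "L2_class \<nu>"] ext)
    fix \<delta>
    have "ch \<epsilon> (- (t1 + t2)) * cnj (ch \<gamma>2 t1) = ch (\<epsilon> + \<gamma>2) (- t1) * ch \<epsilon> (- t2)" for \<epsilon>
      by (simp add: ch_add ch_uminus ch_plus_apply mult_ac del: minus_add_distrib)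
    from this[of "\<delta> - \<gamma>1 - \<gamma>2"]
    show "ch (\<delta> - \<gamma>1) (- t1) * (ch (\<delta> - \<gamma>1 - \<gamma>2) (- t2) * f (\<delta> - \<gamma>1 - \<gamma>2)) =
        \<sigma> g h * (ch (\<delta> - (\<gamma>1 + \<gamma>2)) (- (t1 + t2)) * f (\<delta> - (\<gamma>1 + \<gamma>2)))"
      by (simp add: gh \<sigma>_def diff_diff_eq[symmetric] mult_ac del: minus_add_distrib)
  qed
  also have "\<dots> = L2_scale \<nu> (\<sigma> g h) ((\<pi>_op \<nu> \<circ> \<iota>) (g + h) X)"
    unfolding f(1) gh by (simp only: add_Pair \<iota> \<pi>_op_class[OF \<nu> f(2)] L2_scale_class[OF shf])
  finally show ?thesis .
qed

end

theory Submission
  imports Defs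
begin

text \<open>The Plancherel identity makes the transform an isometry of \<open>L2 \<mu>\<close> into \<open>L2 \<nu>\<close>, and the
  intertwining relations hold on integrable functions by a change of variable, hence everywhere by
  continuity. The point is surjectivity. The range is closed, and since translations become
  modulations it is stable under multiplication by the functions \<open>\<lambda>\<delta>. ch \<delta> t\<close>. The bounded
  measurable functions that multiply the range into itself form an algebra closed under bounded
  pointwise limits; by the Weierstrass theorem on the circle and second countability it contains
  all indicators of Borel sets, hence all bounded measurable functions. So the range contains every
  square-integrable function living where some given transform does not vanish. The transform of
  \<open>\<gamma>\<close> cut off to a compact set does not vanish near \<open>\<gamma>\<close>, and countably many of these
  neighbourhoods cover the dual.\<close>

section \<open>Square-integrable functions\<close>

text \<open>Surjectivity is usually drawn from the inversion formula or from duality. Here the only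
  input is the Plancherel identity, so the range is studied as a closed subspace stable under all
  modulations \<open>\<lambda>\<delta>. ch \<delta> t\<close>. As in Wiener's theorem on
  translation-invariant subspaces, such a space should consist of the square-integrable functions
  vanishing off some set, and that set is everything once the transforms have no common zero. The
  obstacle is the upgrade from characters to Borel indicators: the dual need not be compact, so
  uniform approximation on the dual itself is out of reach. A polynomial in one character, however,
  is a function on the circle, which is compact; this handles each \<open>t\<close> separately,
  countable intersections over \<open>t\<close> then give the cells of a network, and countable
  unions of cells give the open sets. All analysis is done on functions through the relation
  \<open>FT\<close>; classes appear only at the end.\<close>

definition l2norm :: "'a measure \<Rightarrow> ('a \<Rightarrow> complex) \<Rightarrow> real" where
  "l2norm M f = sqrt (LINT x|M. (cmod (f x))\<^sup>2)"

lemma L2_funD [measurable_dest]: "f \<in> L2_fun M \<Longrightarrow> f \<in> borel_measurable M"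
  by (simp add: L2_fun_def)

lemma L2_fun_integrable: "f \<in> L2_fun M \<Longrightarrow> integrable M (\<lambda>x. (cmod (f x))\<^sup>2)"
  by (simp add: L2_fun_def)

lemma L2_fun_dominated:
  assumes "g \<in> L2_fun M" "f \<in> borel_measurable M" "AE x in M. cmod (f x) \<le> C * cmod (g x)"
  shows "f \<in> L2_fun M"
proof -
  have "integrable M (\<lambda>x. C\<^sup>2 * (cmod (g x))\<^sup>2)"
    using L2_fun_integrable[OF assms(1)] by simp
  then have "integrable M (\<lambda>x. (cmod (f x))\<^sup>2)"
  proof (rule Bochner_Integration.integrable_bound)
    show "AE x in M. norm ((cmod (f x))\<^sup>2) \<le> norm (C\<^sup>2 * (cmod (g x))\<^sup>2)"
      using assms(3)
    proof eventually_elim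
      case (elim x)
      from power_mono[OF elim, of 2] show ?case by (simp add: power_mult_distrib)
    qed
  qed (use assms in measurable)
  with assms show ?thesis by (simp add: L2_fun_def)
qed

lemma L2_fun_cmult: "f \<in> L2_fun M \<Longrightarrow> (\<lambda>x. c * f x) \<in> L2_fun M"
  by (rule L2_fun_dominated[where C = "cmod c"]) (auto simp: norm_mult L2_funD)

lemma l2norm_nonneg [simp]: "0 \<le> l2norm M f"
  by (simp add: l2norm_def)

lemma l2norm_square: "(l2norm M f)\<^sup>2 = (LINT x|M. (cmod (f x))\<^sup>2)"
  by (simp add: l2norm_def)

lemma nn_integral_l2norm:
  "f \<in> L2_fun M \<Longrightarrow> (\<integral>\<^sup>+x. ennreal ((cmod (f x))\<^sup>2) \<partial>M) = ennreal ((l2norm M f)\<^sup>2)"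
  unfolding l2norm_square by (rule nn_integral_eq_integral) (auto simp: L2_fun_integrable)

text \<open>With the nonnegative integral the bound already forces square-integrability. This is the
  form in which Fatou's lemma delivers an estimate for a limit not yet known to lie in
  \<open>L2_fun\<close>.\<close>

lemma l2norm_leI:
  assumes f: "f \<in> borel_measurable M" and e: "0 \<le> e"
    and le: "(\<integral>\<^sup>+x. ennreal ((cmod (f x))\<^sup>2) \<partial>M) \<le> ennreal (e\<^sup>2)"
  shows "f \<in> L2_fun M" "l2norm M f \<le> e"
proof -
  have "integrable M (\<lambda>x. (cmod (f x))\<^sup>2)"
    using f le le_less_trans[OF le ennreal_less_top] by (intro integrableI_bounded) auto
  with f show *: "f \<in> L2_fun M" by (simp add: L2_fun_def)
  from le have "(l2norm M f)\<^sup>2 \<le> e\<^sup>2"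
    unfolding nn_integral_l2norm[OF *] by (simp add: ennreal_le_iff)
  then show "l2norm M f \<le> e" using e by (rule power2_le_imp_le)
qed

lemma l2norm_cong_AE:
  assumes "AE x in M. f x = g x" "f \<in> borel_measurable M" "g \<in> borel_measurable M"
  shows "l2norm M f = l2norm M g"
  unfolding l2norm_def
  by (rule arg_cong[where f = sqrt], rule integral_cong_AE) (use assms in auto)

lemma l2norm_eq_0_iff:
  assumes "f \<in> L2_fun M"
  shows "l2norm M f = 0 \<longleftrightarrow> (AE x in M. f x = 0)"
  using integral_nonneg_eq_0_iff_AE[OF L2_fun_integrable[OF assms]] by (simp add: l2norm_def)

lemma l2norm_cmult: "l2norm M (\<lambda>x. c * f x) = cmod c * l2norm M f"
  by (simp add: l2norm_def norm_mult power_mult_distrib real_sqrt_mult)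

lemma l2norm_minus_commute: "l2norm M (\<lambda>x. f x - g x) = l2norm M (\<lambda>x. g x - f x)"
  by (simp add: l2norm_def norm_minus_commute)

text \<open>The gap is the square \<open>(a * q - b * p)^2 / (p * q)\<close>. The right side is
  linear in \<open>a^2\<close> and \<open>b^2\<close>, so it integrates termwise; weights close to
  the norms of two functions then yield Minkowski's inequality.\<close>

lemma weighted_square_sum:
  fixes a b p q :: real
  assumes "0 < p" "0 < q"
  shows "(a + b)\<^sup>2 \<le> (p + q) * (a\<^sup>2 / p + b\<^sup>2 / q)"
proof -
  have "(p + q) * (a\<^sup>2 / p + b\<^sup>2 / q) - (a + b)\<^sup>2 = (a * q - b * p)\<^sup>2 / (p * q)"
    using assms by (simp add: field_simps power2_eq_square)
  also have "\<dots> \<ge> 0" using assms by simp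
  finally show ?thesis by simp
qed

lemma
  assumes f: "f \<in> L2_fun M" and g: "g \<in> L2_fun M"
  shows L2_fun_add: "(\<lambda>x. f x + g x) \<in> L2_fun M"
    and l2norm_triangle: "l2norm M (\<lambda>x. f x + g x) \<le> l2norm M f + l2norm M g"
proof -
  have pw: "(cmod (f x + g x))\<^sup>2 \<le> (p + q) * ((cmod (f x))\<^sup>2 / p + (cmod (g x))\<^sup>2 / q)"
    if "0 < p" "0 < q" for p q x
    using order_trans[OF power_mono[OF norm_triangle_ineq[of "f x" "g x"]] weighted_square_sum[OF that]]
    by simp
  have int: "integrable M (\<lambda>x. (p + q) * ((cmod (f x))\<^sup>2 / p + (cmod (g x))\<^sup>2 / q))" for p q
    using f g by (intro integrable_mult_right Bochner_Integration.integrable_add integrable_divide L2_fun_integrable)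
  have "integrable M (\<lambda>x. (cmod (f x + g x))\<^sup>2)"
    by (rule Bochner_Integration.integrable_bound[OF int[of 1 1]])
      (use f g pw[of 1 1] in \<open>auto intro!: borel_measurable_power dest!: L2_funD\<close>)
  with f g show fg: "(\<lambda>x. f x + g x) \<in> L2_fun M"
    by (auto simp: L2_fun_def)
  \<comment> \<open>Weights strictly above the two norms avoid a separate treatment of zero norms.\<close>
  have *: "l2norm M (\<lambda>x. f x + g x) \<le> p + q" if p: "l2norm M f < p" and q: "l2norm M g < q" for p q
  proof -
    have pq: "0 < p" "0 < q" using p q l2norm_nonneg[of M f] l2norm_nonneg[of M g] by linarith+
    have "(l2norm M (\<lambda>x. f x + g x))\<^sup>2 \<le>
        (LINT x|M. (p + q) * ((cmod (f x))\<^sup>2 / p + (cmod (g x))\<^sup>2 / q))"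
      unfolding l2norm_square by (intro integral_mono L2_fun_integrable fg int pw pq)
    also have "\<dots> = (p + q) * ((l2norm M f)\<^sup>2 / p + (l2norm M g)\<^sup>2 / q)"
      unfolding l2norm_square using f g by (simp add: L2_fun_integrable)
    also have "\<dots> \<le> (p + q) * (p\<^sup>2 / p + q\<^sup>2 / q)"
      using p q pq by (intro mult_left_mono add_mono divide_right_mono power_mono) auto
    also have "\<dots> = (p + q)\<^sup>2" using pq by (simp add: power2_eq_square)
    finally show ?thesis by (rule power2_le_imp_le) (use pq in simp)
  qed
  show "l2norm M (\<lambda>x. f x + g x) \<le> l2norm M f + l2norm M g"
  proof (rule field_le_epsilon)
    fix e :: real assume "0 < e"
    then show "l2norm M (\<lambda>x. f x + g x) \<le> l2norm M f + l2norm M g + e"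
      using *[of "l2norm M f + e/2" "l2norm M g + e/2"] by simp
  qed
qed

lemma L2_fun_diff: "f \<in> L2_fun M \<Longrightarrow> g \<in> L2_fun M \<Longrightarrow> (\<lambda>x. f x - g x) \<in> L2_fun M"
  using L2_fun_add[of f M "\<lambda>x. (-1) * g x"] L2_fun_cmult[of g M "-1"] by simp

lemma l2norm_triangle_diff:
  assumes "f \<in> L2_fun M" "g \<in> L2_fun M" "h \<in> L2_fun M"
  shows "l2norm M (\<lambda>x. f x - h x) \<le> l2norm M (\<lambda>x. f x - g x) + l2norm M (\<lambda>x. g x - h x)"
  using l2norm_triangle[of "\<lambda>x. f x - g x" M "\<lambda>x. g x - h x"] assms by (simp add: L2_fun_diff)

lemma L2_fun_integrable_mult_cnj:
  assumes f: "f \<in> L2_fun M" and g: "g \<in> L2_fun M"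
  shows "integrable M (\<lambda>x. f x * cnj (g x))"
proof (rule Bochner_Integration.integrable_bound)
  show "integrable M (\<lambda>x. (cmod (f x))\<^sup>2 + (cmod (g x))\<^sup>2)"
    using f g by (intro Bochner_Integration.integrable_add L2_fun_integrable)
  have "a * b \<le> a\<^sup>2 + b\<^sup>2" if "0 \<le> a" "0 \<le> b" for a b :: real
    using sum_squares_bound[of a b] mult_nonneg_nonneg[OF that] by linarith
  then show "AE x in M. norm (f x * cnj (g x)) \<le> norm ((cmod (f x))\<^sup>2 + (cmod (g x))\<^sup>2)"
    by (simp add: norm_mult)
  show "(\<lambda>x. f x * cnj (g x)) \<in> borel_measurable M"
    using f g by (auto dest!: L2_funD intro!: borel_measurable_times measurable_compose[OF _ borel_measurable_continuous_onI[OF continuous_on_cnj[OF continuous_on_id]]])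
qed

lemma
  assumes meas: "\<And>n. u n \<in> borel_measurable M" and g: "g \<in> L2_fun M"
    and bound: "\<And>n x. cmod (u n x) \<le> cmod (g x)"
    and lim: "\<And>x. x \<in> space M \<Longrightarrow> (\<lambda>n::nat. u n x) \<longlonglongrightarrow> v x"
  shows L2_fun_dominated_limit: "v \<in> L2_fun M"
    and L2_dominated_convergence: "(\<lambda>n. l2norm M (\<lambda>x. u n x - v x)) \<longlonglongrightarrow> 0"
proof -
  have [measurable]: "v \<in> borel_measurable M"
    by (rule borel_measurable_LIMSEQ_metric[OF meas lim])
  have v: "cmod (v x) \<le> cmod (g x)" if "x \<in> space M" for x
    using LIMSEQ_le_const2[OF tendsto_norm[OF lim[OF that]]] bound by blast
  then show "v \<in> L2_fun M"
    by (intro L2_fun_dominated[OF g, where C = 1]) auto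
  have "(\<lambda>n. LINT x|M. (cmod (u n x - v x))\<^sup>2) \<longlonglongrightarrow> (LINT x|M. 0)"
  proof (rule integral_dominated_convergence)
    show "integrable M (\<lambda>x. 4 * (cmod (g x))\<^sup>2)"
      using L2_fun_integrable[OF g] by simp
    show "AE x in M. (\<lambda>n. (cmod (u n x - v x))\<^sup>2) \<longlonglongrightarrow> 0"
    proof (rule AE_I2)
      fix x assume "x \<in> space M"
      from tendsto_power[OF tendsto_norm[OF tendsto_diff[OF lim[OF this] tendsto_const]], of "v x" 2]
      show "(\<lambda>n. (cmod (u n x - v x))\<^sup>2) \<longlonglongrightarrow> 0" by simp
    qed
    show "AE x in M. norm ((cmod (u n x - v x))\<^sup>2) \<le> 4 * (cmod (g x))\<^sup>2" for n
    proof (rule AE_I2)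
      fix x assume "x \<in> space M"
      then have "cmod (u n x - v x) \<le> 2 * cmod (g x)"
        using norm_triangle_ineq4[of "u n x" "v x"] bound[of n x] v by fastforce
      from power_mono[OF this, of 2]
      show "norm ((cmod (u n x - v x))\<^sup>2) \<le> 4 * (cmod (g x))\<^sup>2"
        by (simp add: power_mult_distrib)
    qed
  qed (use meas in measurable)
  then show "(\<lambda>n. l2norm M (\<lambda>x. u n x - v x)) \<longlonglongrightarrow> 0"
    unfolding l2norm_def using tendsto_real_sqrt by fastforce
qed

section \<open>Completeness (Riesz-Fischer)\<close>

lemma term_le_of_ennreal_suminf:
  fixes t :: "nat \<Rightarrow> real"
  assumes "(\<Sum>k. ennreal (t k)) \<noteq> \<infinity>" "0 \<le> t k"
  shows "t k \<le> enn2real (\<Sum>k. ennreal (t k))"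
proof -
  have "(\<Sum>k\<in>{k}. ennreal (t k)) \<le> (\<Sum>k. ennreal (t k))"
    by (rule sum_le_suminf) auto
  then have "enn2real (ennreal (t k)) \<le> enn2real (\<Sum>k. ennreal (t k))"
    using assms by (intro enn2real_mono) (auto simp: less_top)
  then show ?thesis using assms(2) by simp
qed

text \<open>A rapidly converging subsequence converges almost everywhere, and Fatou's lemma along it
  carries the Cauchy bound over to the pointwise limit.\<close>

lemma L2_complete:
  assumes f: "\<And>n::nat. f n \<in> L2_fun M"
    and Cauchy: "\<And>e. 0 < e \<Longrightarrow> \<exists>N. \<forall>m\<ge>N. \<forall>n\<ge>N. l2norm M (\<lambda>x. f m x - f n x) < e"
  shows "\<exists>g\<in>L2_fun M. (\<lambda>n. l2norm M (\<lambda>x. f n x - g x)) \<longlonglongrightarrow> 0"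
proof -
  have [measurable]: "f n \<in> borel_measurable M" for n using f by (rule L2_funD)
  \<comment> \<open>The bound \<open>(1/4)^k\<close> enters squared, so multiplied by the weight
    \<open>4^k\<close> it is again \<open>(1/4)^k\<close>, which is summable.\<close>
  have "\<exists>N. \<forall>m\<ge>N. \<forall>n\<ge>N. l2norm M (\<lambda>x. f m x - f n x) < (1/4)^k" for k :: nat
    by (rule Cauchy) simp
  then obtain N where N: "\<And>k m n. m \<ge> N k \<Longrightarrow> n \<ge> N k \<Longrightarrow> l2norm M (\<lambda>x. f m x - f n x) < (1/4)^k"
    by metis
  \<comment> \<open>Sums of \<open>N\<close> dominate \<open>N k\<close> without \<open>N\<close>
    being monotone; the summand \<open>k\<close> makes \<open>r\<close> tend to infinity.\<close>
  define r where "r k = k + (\<Sum>i\<le>k. N i)" for k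
  have r: "N k \<le> r k" "N k \<le> r (Suc k)" "k \<le> r k" for k
    by (auto simp: r_def intro: trans_le_add2 member_le_sum order_trans[OF member_le_sum[of k "{..k}" N]])
  define d where "d k x = f (r (Suc k)) x - f (r k) x" for k x
  have d: "d k \<in> L2_fun M" for k unfolding d_def by (intro L2_fun_diff f)
  have [measurable]: "d k \<in> borel_measurable M" for k using d by (rule L2_funD)
  \<comment> \<open>The weights \<open>4^k\<close> turn the fast convergence in norm into the almost everywhere bound
    \<open>\<bar>d k x\<bar> \<le> c (1/2)^k\<close>, with \<open>c\<close> depending on \<open>x\<close>.\<close>
  have "(\<integral>\<^sup>+x. ennreal (4^k * (cmod (d k x))\<^sup>2) \<partial>M) \<le> ennreal ((1/4)^k)" for k
  proof -
    have "(l2norm M (d k))\<^sup>2 \<le> ((1/4)^k)\<^sup>2"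
      unfolding d_def by (intro power_mono less_imp_le[OF N] r) simp
    then have "4^k * (l2norm M (d k))\<^sup>2 \<le> 4^k * ((1/4)^k)\<^sup>2"
      by (intro mult_left_mono) auto
    also have "\<dots> = (1/4)^k"
      by (simp add: power2_eq_square power_one_over field_simps)
    finally have le: "4^k * (l2norm M (d k))\<^sup>2 \<le> (1/4)^k" .
    have "(\<integral>\<^sup>+x. ennreal (4^k * (cmod (d k x))\<^sup>2) \<partial>M) =
        (\<integral>\<^sup>+x. ennreal (4^k) * ennreal ((cmod (d k x))\<^sup>2) \<partial>M)"
      by (intro nn_integral_cong ennreal_mult) auto
    also have "\<dots> = ennreal (4^k) * ennreal ((l2norm M (d k))\<^sup>2)"
      unfolding nn_integral_l2norm[OF d, symmetric] by (rule nn_integral_cmult) measurable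
    also have "\<dots> = ennreal (4^k * (l2norm M (d k))\<^sup>2)"
      by (rule ennreal_mult[symmetric]) auto
    finally show ?thesis using le by (simp only: ennreal_leI)
  qed
  then have "(\<integral>\<^sup>+x. (\<Sum>k. ennreal (4^k * (cmod (d k x))\<^sup>2)) \<partial>M) \<le> (\<Sum>k. ennreal ((1/4)^k))"
    by (subst nn_integral_suminf) (auto intro!: suminf_le)
  also have "\<dots> < \<infinity>"
    by (subst suminf_ennreal2) auto
  finally have "AE x in M. (\<Sum>k. ennreal (4^k * (cmod (d k x))\<^sup>2)) \<noteq> \<infinity>"
    by (intro nn_integral_PInf_AE) auto
  then have conv: "AE x in M. convergent (\<lambda>k. f (r k) x)"
  proof eventually_elim
    case (elim x)
    have "0 \<le> 4^k * (cmod (d k x))\<^sup>2" for k by simp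
    from term_le_of_ennreal_suminf[OF elim this]
    obtain S where S: "4^k * (cmod (d k x))\<^sup>2 \<le> S" for k by blast
    have "cmod (d k x) \<le> sqrt S * (1/2)^k" for k
    proof -
      have pow: "(2^k)\<^sup>2 = (4::real)^k"
        by (simp add: power2_eq_square flip: power_mult_distrib)
      have "(2^k * cmod (d k x))\<^sup>2 \<le> S"
        using S[of k] unfolding power_mult_distrib pow by simp
      then have "2^k * cmod (d k x) \<le> sqrt S"
        by (rule real_le_rsqrt)
      then show ?thesis by (simp add: field_simps power_one_over)
    qed
    moreover have "summable (\<lambda>k. sqrt S * (1/2)^k)"
      by (intro summable_mult summable_geometric) simp
    ultimately have "summable (\<lambda>k. d k x)"
      by (blast intro: summable_comparison_test')
    then have "convergent (\<lambda>n. \<Sum>k<n. d k x)"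
      by (simp add: summable_iff_convergent)
    then have "convergent (\<lambda>n. f (r n) x - f (r 0) x)"
      using sum_lessThan_telescope[of "\<lambda>k. f (r k) x"] by (simp add: d_def)
    then show ?case
      using convergent_add[of "\<lambda>n. f (r n) x - f (r 0) x" "\<lambda>_. f (r 0) x"] by (simp add: convergent_const)
  qed
  \<comment> \<open>Where the subsequence diverges, \<open>lim\<close> is one fixed unspecified
    value; this happens only on a null set.\<close>
  define g where "g x = lim (\<lambda>k. f (r k) x)" for x
  have [measurable]: "g \<in> borel_measurable M"
    unfolding g_def by measurable
  have approx: "(\<lambda>x. f n x - g x) \<in> L2_fun M \<and> l2norm M (\<lambda>x. f n x - g x) \<le> e"
    if e: "0 < e" and n: "\<And>m. m \<ge> n \<Longrightarrow> l2norm M (\<lambda>x. f n x - f m x) < e" for n e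
  proof -
    have "(\<integral>\<^sup>+x. ennreal ((cmod (f n x - g x))\<^sup>2) \<partial>M) =
        (\<integral>\<^sup>+x. liminf (\<lambda>k. ennreal ((cmod (f n x - f (r k) x))\<^sup>2)) \<partial>M)"
    proof (rule nn_integral_cong_AE)
      show "AE x in M. ennreal ((cmod (f n x - g x))\<^sup>2) =
          liminf (\<lambda>k. ennreal ((cmod (f n x - f (r k) x))\<^sup>2))"
        using conv
      proof eventually_elim
        case (elim x)
        then have "(\<lambda>k. f (r k) x) \<longlonglongrightarrow> g x" by (simp add: g_def convergent_LIMSEQ_iff)
        then have "(\<lambda>k. ennreal ((cmod (f n x - f (r k) x))\<^sup>2)) \<longlonglongrightarrow> ennreal ((cmod (f n x - g x))\<^sup>2)"
          by (intro tendsto_intros)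
        then show ?case by (intro lim_imp_Liminf[symmetric]) auto
      qed
    qed
    also have "\<dots> \<le> liminf (\<lambda>k. (\<integral>\<^sup>+x. ennreal ((cmod (f n x - f (r k) x))\<^sup>2) \<partial>M))"
      by (rule nn_integral_liminf) measurable
    also have "\<dots> \<le> limsup (\<lambda>k. (\<integral>\<^sup>+x. ennreal ((cmod (f n x - f (r k) x))\<^sup>2) \<partial>M))"
      by (intro Liminf_le_Limsup) simp
    also have "\<dots> \<le> ennreal (e\<^sup>2)"
    proof (rule Limsup_bounded)
      show "\<forall>\<^sub>F k in sequentially. (\<integral>\<^sup>+x. ennreal ((cmod (f n x - f (r k) x))\<^sup>2) \<partial>M) \<le> ennreal (e\<^sup>2)"
        unfolding eventually_sequentially
      proof (intro exI allI impI)
        fix k assume "n \<le> k"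
        then have "n \<le> r k" using r(3)[of k] by linarith
        from n[OF this] show "(\<integral>\<^sup>+x. ennreal ((cmod (f n x - f (r k) x))\<^sup>2) \<partial>M) \<le> ennreal (e\<^sup>2)"
          by (subst nn_integral_l2norm) (auto intro!: L2_fun_diff f ennreal_leI power_mono)
      qed
    qed
    finally show ?thesis
      using l2norm_leI[of "\<lambda>x. f n x - g x" M e] e by auto
  qed
  obtain n where n: "\<And>m. m \<ge> n \<Longrightarrow> l2norm M (\<lambda>x. f n x - f m x) < 1"
    using Cauchy[of 1] by auto
  \<comment> \<open>Fatou's lemma controls only differences with \<open>g\<close>, so
    \<open>g\<close> itself is recovered from such a difference.\<close>
  have "(\<lambda>x. f n x - (f n x - g x)) \<in> L2_fun M"
    by (rule L2_fun_diff[OF f approx[OF zero_less_one n, THEN conjunct1]])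
  then have g: "g \<in> L2_fun M" by simp
  moreover have "(\<lambda>n. l2norm M (\<lambda>x. f n x - g x)) \<longlonglongrightarrow> 0"
  proof (rule LIMSEQ_I)
    fix e :: real assume e: "0 < e"
    then obtain N where "\<forall>m\<ge>N. \<forall>n\<ge>N. l2norm M (\<lambda>x. f m x - f n x) < e/2"
      using Cauchy[of "e/2"] by auto
    then have "l2norm M (\<lambda>x. f n x - g x) \<le> e/2" if "n \<ge> N" for n
      using approx[of "e/2" n] e that by auto
    then show "\<exists>N. \<forall>n\<ge>N. norm (l2norm M (\<lambda>x. f n x - g x) - 0) < e"
      using e by (intro exI[of _ N]) fastforce
  qed
  ultimately show ?thesis by blast
qed

text \<open>Membership is part of the notion because the integral of a non-integrable function is 0
  by default, so \<open>l2norm\<close> would vanish on functions outside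
  \<open>L2_fun\<close>.\<close>

definition L2_lim :: "'a measure \<Rightarrow> (nat \<Rightarrow> 'a \<Rightarrow> complex) \<Rightarrow> ('a \<Rightarrow> complex) \<Rightarrow> bool" where
  "L2_lim M f g \<longleftrightarrow> (\<forall>n. f n \<in> L2_fun M) \<and> g \<in> L2_fun M \<and>
     (\<lambda>n. l2norm M (\<lambda>x. f n x - g x)) \<longlonglongrightarrow> 0"

lemma L2_limD:
  assumes "L2_lim M f g"
  shows "f n \<in> L2_fun M" "g \<in> L2_fun M" "(\<lambda>n. l2norm M (\<lambda>x. f n x - g x)) \<longlonglongrightarrow> 0"
  using assms by (auto simp: L2_lim_def)

lemma tendsto_0_le_real:
  fixes f g :: "nat \<Rightarrow> real"
  assumes "\<And>n. 0 \<le> f n" "\<And>n. f n \<le> g n" "g \<longlonglongrightarrow> 0"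
  shows "f \<longlonglongrightarrow> 0"
  by (rule tendsto_sandwich[OF _ _ tendsto_const assms(3)]) (use assms in auto)

lemma L2_lim_add:
  assumes "L2_lim M f g" "L2_lim M f' g'"
  shows "L2_lim M (\<lambda>n x. f n x + f' n x) (\<lambda>x. g x + g' x)"
proof -
  note [simp] = L2_limD(1,2)[OF assms(1)] L2_limD(1,2)[OF assms(2)]
  have "l2norm M (\<lambda>x. f n x + f' n x - (g x + g' x)) \<le>
      l2norm M (\<lambda>x. f n x - g x) + l2norm M (\<lambda>x. f' n x - g' x)" for n
    using l2norm_triangle[of "\<lambda>x. f n x - g x" M "\<lambda>x. f' n x - g' x"]
    by (simp add: L2_fun_diff add_diff_add)
  moreover have "(\<lambda>n. l2norm M (\<lambda>x. f n x - g x) + l2norm M (\<lambda>x. f' n x - g' x)) \<longlonglongrightarrow> 0"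
    using tendsto_add[OF L2_limD(3)[OF assms(1)] L2_limD(3)[OF assms(2)]] by simp
  ultimately have "(\<lambda>n. l2norm M (\<lambda>x. f n x + f' n x - (g x + g' x))) \<longlonglongrightarrow> 0"
    by (rule tendsto_0_le_real[OF l2norm_nonneg])
  then show ?thesis by (simp add: L2_lim_def L2_fun_add)
qed

lemma L2_lim_cmult:
  assumes "L2_lim M f g"
  shows "L2_lim M (\<lambda>n x. c * f n x) (\<lambda>x. c * g x)"
proof -
  have "(\<lambda>n. cmod c * l2norm M (\<lambda>x. f n x - g x)) \<longlonglongrightarrow> 0"
    using tendsto_mult[OF tendsto_const L2_limD(3)[OF assms], of "cmod c"] by simp
  then show ?thesis
    using assms l2norm_cmult[of M c]
    by (simp add: L2_lim_def L2_fun_cmult flip: right_diff_distrib)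
qed

lemma L2_lim_diff:
  assumes "L2_lim M f g" "L2_lim M f' g'"
  shows "L2_lim M (\<lambda>n x. f n x - f' n x) (\<lambda>x. g x - g' x)"
  using L2_lim_add[OF assms(1) L2_lim_cmult[OF assms(2), of "-1"]] by simp

lemma L2_lim_norm:
  assumes "L2_lim M f g"
  shows "(\<lambda>n. l2norm M (f n)) \<longlonglongrightarrow> l2norm M g"
proof -
  note fg = L2_limD(1,2)[OF assms]
  have "\<bar>l2norm M (f n) - l2norm M g\<bar> \<le> l2norm M (\<lambda>x. f n x - g x)" for n
    using l2norm_triangle[OF L2_fun_diff[OF fg(1)[of n] fg(2)] fg(2)]
      l2norm_triangle[OF L2_fun_diff[OF fg(2) fg(1)[of n]] fg(1)[of n]]
      l2norm_minus_commute[of M "f n" g] by simp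
  then have "(\<lambda>n. \<bar>l2norm M (f n) - l2norm M g\<bar>) \<longlonglongrightarrow> 0"
    by (intro tendsto_0_le_real[OF _ _ L2_limD(3)[OF assms]]) auto
  then show ?thesis
    using LIM_zero_cancel tendsto_rabs_zero_iff by blast
qed

lemma L2_lim_unique:
  assumes "L2_lim M f g" "L2_lim M f h"
  shows "AE x in M. g x = h x"
proof -
  have "(\<lambda>n::nat. l2norm M (\<lambda>x. 0)) \<longlonglongrightarrow> l2norm M (\<lambda>x. g x - h x)"
    using L2_lim_norm[OF L2_lim_diff[OF assms]] by simp
  then have "l2norm M (\<lambda>x. g x - h x) = 0"
    by (simp add: LIMSEQ_const_iff l2norm_def)
  then show ?thesis
    using l2norm_eq_0_iff[OF L2_fun_diff[OF L2_limD(2)[OF assms(1)] L2_limD(2)[OF assms(2)]]] by simp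
qed

lemma L2_lim_const: "f \<in> L2_fun M \<Longrightarrow> L2_lim M (\<lambda>_. f) f"
  by (simp add: L2_lim_def l2norm_def)

lemma L2_lim_cong:
  assumes fg: "L2_lim M f g" and h: "h \<in> L2_fun M" "AE x in M. g x = h x"
  shows "L2_lim M f h"
proof -
  have "l2norm M (\<lambda>x. f n x - g x) = l2norm M (\<lambda>x. f n x - h x)" for n
    by (rule l2norm_cong_AE) (use h L2_limD(1,2)[OF fg] in \<open>auto dest: L2_funD\<close>)
  then show ?thesis using fg h(1) by (simp add: L2_lim_def)
qed

text \<open>The Cauchy property passes from \<open>f\<close> to \<open>u\<close>, and completeness
  does the rest. It is used in both directions: from \<open>\<mu>\<close> to \<open>\<nu>\<close> to
  extend the transform, from \<open>\<nu>\<close> to \<open>\<mu>\<close> to close its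
  range.\<close>

lemma L2_lim_isometric:
  assumes f: "L2_lim M f g" and u: "\<And>n. u n \<in> L2_fun N"
    and iso: "\<And>m n. l2norm N (\<lambda>x. u m x - u n x) = l2norm M (\<lambda>x. f m x - f n x)"
  shows "\<exists>v. L2_lim N u v"
proof -
  have "\<exists>K. \<forall>m\<ge>K. \<forall>n\<ge>K. l2norm N (\<lambda>x. u m x - u n x) < e" if e: "0 < e" for e
  proof -
    obtain K where K: "\<And>n. n \<ge> K \<Longrightarrow> l2norm M (\<lambda>x. f n x - g x) < e/2"
      using LIMSEQ_D[OF L2_limD(3)[OF f], of "e/2"] e by auto
    have "l2norm M (\<lambda>x. f m x - f n x) < e" if "m \<ge> K" "n \<ge> K" for m n
      using l2norm_triangle_diff[of "f m" M g "f n"] K[OF that(1)] K[OF that(2)] f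
        l2norm_minus_commute[of M "f n" g] by (simp add: L2_lim_def)
    then show ?thesis unfolding iso by blast
  qed
  from L2_complete[OF u this] u show ?thesis by (auto simp: L2_lim_def)
qed

text \<open>Small values are cut away: where \<open>cmod (f x)\<close> is at least
  \<open>1/n\<close> it is bounded by \<open>n * (cmod (f x))^2\<close>, which is integrable. The
  condition is written as a product, so \<open>n = 0\<close> gives the zero function.\<close>

lemma L1_L2_dense:
  assumes f: "f \<in> L2_fun M"
  shows "\<exists>h. (\<forall>n. h n \<in> L1_L2_fun M) \<and> L2_lim M h f"
proof -
  note [measurable] = L2_funD[OF f]
  define h where "h n x = (if 1 \<le> real n * cmod (f x) then f x else 0)" for n x
  have [measurable]: "h n \<in> borel_measurable M" for n
    unfolding h_def by measurable
  have L2: "h n \<in> L2_fun M" for n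
    by (rule L2_fun_dominated[OF f, where C = 1]) (auto simp: h_def)
  have "integrable M (h n)" for n
  proof (rule Bochner_Integration.integrable_bound)
    show "integrable M (\<lambda>x. real n * (cmod (f x))\<^sup>2)"
      using L2_fun_integrable[OF f] by simp
    have "cmod (f x) \<le> real n * (cmod (f x))\<^sup>2" if "1 \<le> real n * cmod (f x)" for x
      using mult_right_mono[OF that norm_ge_zero[of "f x"]] by (simp add: power2_eq_square mult.assoc)
    then show "AE x in M. norm (h n x) \<le> norm (real n * (cmod (f x))\<^sup>2)"
      by (auto simp: h_def)
  qed measurable
  with L2 have "h n \<in> L1_L2_fun M" for n by (simp add: L1_L2_fun_def)
  moreover have "(\<lambda>n. h n x) \<longlonglongrightarrow> f x" for x
  proof (cases "f x = 0")
    case False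
    then obtain N where N: "1 < real N * cmod (f x)"
      using ex_less_of_nat_mult[of "cmod (f x)" 1] by auto
    have "h n x = f x" if "n \<ge> N" for n
      using N mult_right_mono[of "real N" "real n" "cmod (f x)"] that by (auto simp: h_def)
    then show ?thesis
      by (intro tendsto_eventually) (auto simp: eventually_sequentially)
  qed (simp add: h_def)
  then have "(\<lambda>n. l2norm M (\<lambda>x. h n x - f x)) \<longlonglongrightarrow> 0"
    by (intro L2_dominated_convergence[where g = f] f) (auto simp: h_def[abs_def])
  ultimately show ?thesis using L2 f by (auto simp: L2_lim_def)
qed

section \<open>Shift invariance of integrals and norms\<close>

lemma integral_shift:
  fixes f :: "'a::topological_ab_group_add \<Rightarrow> 'b::{banach, second_countable_topology}"
  assumes M: "haar_measure M" and f: "f \<in> borel_measurable M"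
  shows "(LINT s|M. f (s - t)) = (LINT s|M. f s)"
  using integral_distr[OF haar_distr_shift(2)[OF M, of t] f] haar_distr_shift(1)[OF M, of t]
  by simp

lemma integrable_shift:
  fixes f :: "'a::topological_ab_group_add \<Rightarrow> 'b::{banach, second_countable_topology}"
  assumes M: "haar_measure M" and f: "integrable M f"
  shows "integrable M (\<lambda>s. f (s - t))"
  using integrable_distr[OF haar_distr_shift(2)[OF M, of t], of f] haar_distr_shift(1)[OF M, of t] f
  by simp

lemma l2norm_shift:
  assumes "haar_measure M" "f \<in> borel_measurable M"
  shows "l2norm M (\<lambda>s. f (s - t)) = l2norm M f"
proof -
  have "(\<lambda>s. (cmod (f s))\<^sup>2) \<in> borel_measurable M" using assms(2) by measurable
  from integral_shift[OF assms(1) this] show ?thesis by (simp add: l2norm_def)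
qed

text \<open>A general unimodular \<open>u\<close> lets the lemma serve both sides of the transform:
  \<open>ch \<gamma>\<close> on the group and
  \<open>\<lambda>\<delta>. ch (\<delta> - \<gamma>) (- t)\<close> on the dual.\<close>

lemma time_frequency_shift_L2_lim:
  assumes M: "haar_measure M" and u: "u \<in> borel_measurable M" "\<And>x. cmod (u x) = 1"
    and f: "L2_lim M f g"
  shows "L2_lim M (\<lambda>n s. u s * f n (s - t)) (\<lambda>s. u s * g (s - t))"
proof -
  note fg = L2_limD(1,2)[OF f]
  have "l2norm M (\<lambda>s. u s * f n (s - t) - u s * g (s - t)) = l2norm M (\<lambda>s. f n s - g s)" for n
    using l2norm_shift[OF M L2_funD[OF L2_fun_diff[OF fg]]] u
    by (simp add: l2norm_def norm_mult flip: right_diff_distrib)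
  with f show ?thesis
    by (simp add: L2_lim_def L2_modulate_fun[OF L2_translate_fun[OF M] u])
qed

lemma complex_indicator_eq: "(indicator A :: 'a \<Rightarrow> complex) = (\<lambda>x. of_real (indicator A x))"
  by (auto simp: indicator_def)

lemma integrable_complex_indicator:
  "A \<in> sets M \<Longrightarrow> emeasure M A < \<infinity> \<Longrightarrow> integrable M (indicator A :: 'a \<Rightarrow> complex)"
  unfolding complex_indicator_eq by (intro integrable_of_real integrable_real_indicator)

lemma integral_complex_indicator:
  "A \<in> sets M \<Longrightarrow> (LINT x|M. indicator A x :: complex) = of_real (measure M A)"
  unfolding complex_indicator_eq by simp

section \<open>A countable network for the dual group\<close>

text \<open>A network rather than a base: its cells are given by closed conditions, so that a countable
  dense subset of \<open>B\<close> decides membership and every cell is a countable intersection of sets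
  \<open>{\<delta>. ch \<delta> s \<in> K}\<close>. Openness of the cells is never needed.\<close>

lemma pdual_countable_network:
  obtains \<C> :: "'a::{topological_ab_group_add, second_countable_topology} pdual set set" where "countable \<C>"
    and "\<And>C. C \<in> \<C> \<Longrightarrow> \<exists>\<F>. finite \<F> \<and> (\<forall>(B, K)\<in>\<F>. open B \<and> closed K) \<and>
          C = (\<Inter>(B, K)\<in>\<F>. {\<delta>. ch \<delta> ` B \<subseteq> K})"
    and "\<And>U \<gamma>. open U \<Longrightarrow> \<gamma> \<in> U \<Longrightarrow> \<exists>C\<in>\<C>. \<gamma> \<in> C \<and> C \<subseteq> U"
proof -
  obtain \<B> :: "'a set set" where \<B>: "countable \<B>" "topological_basis \<B>"
    using ex_countable_basis by blast
  obtain \<V> :: "complex set set" where \<V>: "countable \<V>" "topological_basis \<V>"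
    using ex_countable_basis by blast
  define cell :: "('a set \<times> complex set) set \<Rightarrow> 'a pdual set"
    where "cell \<F> = (\<Inter>(B, K)\<in>\<F>. {\<delta>. ch \<delta> ` B \<subseteq> K})" for \<F>
  \<comment> \<open>Finite families drawn from countable bases are countable in number; taking
    closures of the sets in \<open>\<V>\<close> makes each condition closed.\<close>
  define \<X> where "\<X> = {\<F>. finite \<F> \<and> \<F> \<subseteq> \<B> \<times> closure ` \<V>}"
  have "countable \<X>"
    using countable_Collect_finite_subset[of "\<B> \<times> closure ` \<V>"] \<B>(1) \<V>(1) by (simp add: \<X>_def)
  show thesis
  proof (rule that[of "cell ` \<X>"])
    show "countable (cell ` \<X>)" using \<open>countable \<X>\<close> by simp
  next
    fix C assume "C \<in> cell ` \<X>"
    then obtain \<F> where \<F>: "\<F> \<in> \<X>" "C = cell \<F>" by blast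
    then have "finite \<F> \<and> (\<forall>(B, K)\<in>\<F>. open B \<and> closed K)"
      using topological_basis_open[OF \<B>(2)] by (auto simp: \<X>_def)
    with \<F>(2) show "\<exists>\<F>. finite \<F> \<and> (\<forall>(B, K)\<in>\<F>. open B \<and> closed K) \<and>
          C = (\<Inter>(B, K)\<in>\<F>. {\<delta>. ch \<delta> ` B \<subseteq> K})"
      unfolding cell_def by blast
  next
    fix U :: "'a pdual set" and \<gamma>
    assume "open U" "\<gamma> \<in> U"
    then show "\<exists>C\<in>cell ` \<X>. \<gamma> \<in> C \<and> C \<subseteq> U"
      unfolding open_pdual_def
    proof (induction U rule: generate_topology.induct)
      case UNIV
      \<comment> \<open>The empty family imposes no condition, so its cell is the whole
        dual.\<close>
      have "{} \<in> \<X>" by (simp add: \<X>_def)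
      then have "cell {} \<in> cell ` \<X>" by (rule imageI)
      then show ?case by (intro bexI[of _ "cell {}"]) (auto simp: cell_def)
    next
      case (Int a b)
      then obtain \<F> \<G> where FG: "\<F> \<in> \<X>" "\<G> \<in> \<X>" "\<gamma> \<in> cell \<F>" "cell \<F> \<subseteq> a" "\<gamma> \<in> cell \<G>" "cell \<G> \<subseteq> b"
        by blast
      then have "\<F> \<union> \<G> \<in> \<X>" by (auto simp: \<X>_def)
      then have "cell (\<F> \<union> \<G>) \<in> cell ` \<X>" by (rule imageI)
      moreover have "cell (\<F> \<union> \<G>) = cell \<F> \<inter> cell \<G>" by (simp add: cell_def INF_union)
      ultimately show ?case using FG by (intro bexI[of _ "cell (\<F> \<union> \<G>)"]) auto
    next
      case (UN \<U>)
      then obtain u where "u \<in> \<U>" "\<gamma> \<in> u" by blast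
      with UN.IH[of u] show ?case by blast
    next
      case (Basis S)
      then obtain K W where KW: "S = {\<delta>. ch \<delta> ` K \<subseteq> W}" "compact K" "open W" by blast
      \<comment> \<open>\<open>V\<close> sits in a ball whose closed version lies in
        \<open>W\<close>, so even its closure stays in \<open>W\<close>; \<open>B\<close> comes from
        continuity of \<open>\<gamma>\<close>. Compactness of \<open>K\<close> then leaves finitely
        many such pairs.\<close>
      have "\<exists>B V. B \<in> \<B> \<and> V \<in> \<V> \<and> s \<in> B \<and> closure V \<subseteq> W \<and> ch \<gamma> ` B \<subseteq> V" if s: "s \<in> K" for s
      proof -
        have "ch \<gamma> s \<in> W" using Basis.prems s by (auto simp: KW(1))
        then obtain e where e: "0 < e" "cball (ch \<gamma> s) e \<subseteq> W"
          using KW(3) open_contains_cball by blast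
        then obtain V where V: "V \<in> \<V>" "ch \<gamma> s \<in> V" "V \<subseteq> ball (ch \<gamma> s) e"
          using topological_basisE[OF \<V>(2) open_ball, of "ch \<gamma> s" "ch \<gamma> s" e] by auto
        have "closure V \<subseteq> cball (ch \<gamma> s) e"
          using V(3) ball_subset_cball closed_cball by (intro closure_minimal) blast+
        moreover have "open (ch \<gamma> -` V)"
          using topological_basis_open[OF \<V>(2) V(1)] continuous_on_ch[of UNIV \<gamma>] open_vimage by blast
        then obtain B where "B \<in> \<B>" "s \<in> B" "B \<subseteq> ch \<gamma> -` V"
          using topological_basisE[OF \<B>(2), of "ch \<gamma> -` V" s] V(2) by blast
        ultimately show ?thesis using V(1) e(2) by (intro exI[of _ B] exI[of _ V]) auto
      qed
      then obtain B V where BV: "\<And>s. s \<in> K \<Longrightarrow> B s \<in> \<B> \<and> V s \<in> \<V> \<and> s \<in> B s \<and>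
          closure (V s) \<subseteq> W \<and> ch \<gamma> ` B s \<subseteq> V s"
        by metis
      have "\<And>s. s \<in> K \<Longrightarrow> open (B s)" "K \<subseteq> (\<Union>s\<in>K. B s)"
        using BV topological_basis_open[OF \<B>(2)] by blast+
      then obtain D where D: "D \<subseteq> K" "finite D" "K \<subseteq> (\<Union>s\<in>D. B s)"
        by (rule compactE_image[OF KW(2)])
      define \<F> where "\<F> = (\<lambda>s. (B s, closure (V s))) ` D"
      have "\<F> \<in> \<X>" using D BV by (auto simp: \<F>_def \<X>_def)
      then have "cell \<F> \<in> cell ` \<X>" by (rule imageI)
      moreover have "\<gamma> \<in> cell \<F>"
        using D(1) BV closure_subset by (fastforce simp: \<F>_def cell_def)
      moreover have "cell \<F> \<subseteq> S"
      proof
        fix \<delta> assume "\<delta> \<in> cell \<F>"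
        then have \<delta>: "ch \<delta> ` B d \<subseteq> closure (V d)" if "d \<in> D" for d
          using that by (auto simp: \<F>_def cell_def)
        have "ch \<delta> s \<in> W" if s: "s \<in> K" for s
        proof -
          obtain d where d: "d \<in> D" "s \<in> B d" using D(3) s by blast
          then have "closure (V d) \<subseteq> W" using BV D(1) by blast
          with \<delta>[OF d(1)] d(2) show ?thesis by blast
        qed
        then show "\<delta> \<in> S" by (auto simp: KW(1))
      qed
      ultimately show ?case by blast
    qed
  qed
qed

section \<open>Extension of the transform by continuity\<close>

locale plancherel_pair =
  fixes \<mu> :: "'a::{topological_ab_group_add, second_countable_topology} measure"
    and \<nu> :: "'a pdual measure"
  assumes haar: "haar_measure \<mu>" and plancherel: "plancherel_measure \<mu> \<nu>"
begin

lemma haar_dual: "haar_measure \<nu>"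
  using plancherel by (simp add: plancherel_measure_def)

lemma integrable_mult_ch:
  assumes "integrable \<mu> f"
  shows "integrable \<mu> (\<lambda>s. f s * cnj (ch \<gamma> s))"
proof (rule Bochner_Integration.integrable_bound[OF assms])
  have "(\<lambda>s. f s * ch (- \<gamma>) s) \<in> borel_measurable \<mu>"
    by (intro borel_measurable_times measurable_ch[OF haar] borel_measurable_integrable assms)
  then show "(\<lambda>s. f s * cnj (ch \<gamma> s)) \<in> borel_measurable \<mu>"
    by (simp add: ch_uminus_apply)
qed (simp add: norm_mult)

lemma fourier_add:
  assumes "integrable \<mu> f" "integrable \<mu> g"
  shows "fourier \<mu> (\<lambda>s. f s + g s) = (\<lambda>\<gamma>. fourier \<mu> f \<gamma> + fourier \<mu> g \<gamma>)"
  using assms by (simp add: fun_eq_iff fourier_def distrib_right integrable_mult_ch)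

lemma fourier_cmult: "fourier \<mu> (\<lambda>s. c * f s) = (\<lambda>\<gamma>. c * fourier \<mu> f \<gamma>)"
  by (simp add: fun_eq_iff fourier_def mult.assoc)

lemma L1_L2_fun_add: "f \<in> L1_L2_fun \<mu> \<Longrightarrow> g \<in> L1_L2_fun \<mu> \<Longrightarrow> (\<lambda>s. f s + g s) \<in> L1_L2_fun \<mu>"
  by (simp add: L1_L2_fun_def L2_fun_add)

lemma L1_L2_fun_cmult: "f \<in> L1_L2_fun \<mu> \<Longrightarrow> (\<lambda>s. c * f s) \<in> L1_L2_fun \<mu>"
  by (simp add: L1_L2_fun_def L2_fun_cmult)

lemma L1_L2_fun_diff: "f \<in> L1_L2_fun \<mu> \<Longrightarrow> g \<in> L1_L2_fun \<mu> \<Longrightarrow> (\<lambda>s. f s - g s) \<in> L1_L2_fun \<mu>"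
  by (simp add: L1_L2_fun_def L2_fun_diff)

lemma fourier_diff:
  assumes "integrable \<mu> f" "integrable \<mu> g"
  shows "fourier \<mu> (\<lambda>s. f s - g s) = (\<lambda>\<gamma>. fourier \<mu> f \<gamma> - fourier \<mu> g \<gamma>)"
  using fourier_add[OF assms(1) integrable_mult_right[OF assms(2)], of "-1"]
  by (simp add: fourier_cmult[of "-1", simplified])

lemma
  assumes "f \<in> L1_L2_fun \<mu>"
  shows fourier_L2_fun: "fourier \<mu> f \<in> L2_fun \<nu>"
    and l2norm_fourier: "l2norm \<nu> (fourier \<mu> f) = l2norm \<mu> f"
  using plancherel assms by (auto simp: plancherel_measure_def l2norm_def)

text \<open>The graph of the extended transform between representatives, mirroring the property
  inside \<open>L2_fourier\<close>. As a relation it allows existence, uniqueness and surjectivity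
  to be proved separately, with no choice of representatives.\<close>

definition FT :: "('a \<Rightarrow> complex) \<Rightarrow> ('a pdual \<Rightarrow> complex) \<Rightarrow> bool" where
  "FT f F \<longleftrightarrow> (\<exists>h. (\<forall>n. h n \<in> L1_L2_fun \<mu>) \<and> L2_lim \<mu> h f \<and> L2_lim \<nu> (\<lambda>n. fourier \<mu> (h n)) F)"

lemma FT_L2_fun: "FT f F \<Longrightarrow> f \<in> L2_fun \<mu>" "FT f F \<Longrightarrow> F \<in> L2_fun \<nu>"
  by (auto simp: FT_def dest: L2_limD)

lemma FT_fourier: "f \<in> L1_L2_fun \<mu> \<Longrightarrow> FT f (fourier \<mu> f)"
  unfolding FT_def
  by (rule exI[of _ "\<lambda>_. f"]) (auto intro!: L2_lim_const fourier_L2_fun simp: L1_L2_fun_def)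

lemma FT_exists:
  assumes "f \<in> L2_fun \<mu>"
  shows "\<exists>F. FT f F"
proof -
  obtain h where h: "\<And>n. h n \<in> L1_L2_fun \<mu>" "L2_lim \<mu> h f"
    using L1_L2_dense[OF assms] by blast
  have int: "integrable \<mu> (h n)" for n using h(1)[of n] by (simp add: L1_L2_fun_def)
  have "\<exists>F. L2_lim \<nu> (\<lambda>n. fourier \<mu> (h n)) F"
  proof (rule L2_lim_isometric[OF h(2) fourier_L2_fun[OF h(1)]])
    fix m n
    show "l2norm \<nu> (\<lambda>x. fourier \<mu> (h m) x - fourier \<mu> (h n) x) = l2norm \<mu> (\<lambda>x. h m x - h n x)"
      using l2norm_fourier[OF L1_L2_fun_diff[OF h(1) h(1)], of m n]
      by (simp add: fourier_diff[OF int int])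
  qed
  with h show ?thesis by (auto simp: FT_def)
qed

lemma FT_add:
  assumes "FT f F" "FT g G"
  shows "FT (\<lambda>x. f x + g x) (\<lambda>x. F x + G x)"
proof -
  obtain h k where h: "\<And>n. h n \<in> L1_L2_fun \<mu>" "L2_lim \<mu> h f" "L2_lim \<nu> (\<lambda>n. fourier \<mu> (h n)) F"
    and k: "\<And>n. k n \<in> L1_L2_fun \<mu>" "L2_lim \<mu> k g" "L2_lim \<nu> (\<lambda>n. fourier \<mu> (k n)) G"
    using assms by (auto simp: FT_def)
  have "integrable \<mu> (h n)" "integrable \<mu> (k n)" for n
    using h(1)[of n] k(1)[of n] by (auto simp: L1_L2_fun_def)
  note sum = fourier_add[OF this]
  show ?thesis
    unfolding FT_def
  proof (intro exI conjI allI)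
    show "(\<lambda>x. h n x + k n x) \<in> L1_L2_fun \<mu>" for n by (intro L1_L2_fun_add h k)
    show "L2_lim \<mu> (\<lambda>n x. h n x + k n x) (\<lambda>x. f x + g x)" by (intro L2_lim_add h k)
    show "L2_lim \<nu> (\<lambda>n. fourier \<mu> (\<lambda>x. h n x + k n x)) (\<lambda>x. F x + G x)"
      unfolding sum by (intro L2_lim_add h k)
  qed
qed

lemma FT_cmult:
  assumes "FT f F"
  shows "FT (\<lambda>x. c * f x) (\<lambda>x. c * F x)"
proof -
  obtain h where h: "\<And>n. h n \<in> L1_L2_fun \<mu>" "L2_lim \<mu> h f" "L2_lim \<nu> (\<lambda>n. fourier \<mu> (h n)) F"
    using assms by (auto simp: FT_def)
  then show ?thesis
    unfolding FT_def
    by (intro exI[of _ "\<lambda>n x. c * h n x"]) (simp add: L1_L2_fun_cmult L2_lim_cmult fourier_cmult)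
qed

lemma FT_diff: "FT f F \<Longrightarrow> FT g G \<Longrightarrow> FT (\<lambda>x. f x - g x) (\<lambda>x. F x - G x)"
  using FT_add[of f F, OF _ FT_cmult[of g G "-1"]] by simp

lemma FT_isometry:
  assumes "FT f F"
  shows "l2norm \<nu> F = l2norm \<mu> f"
proof -
  obtain h where h: "\<And>n. h n \<in> L1_L2_fun \<mu>" "L2_lim \<mu> h f" "L2_lim \<nu> (\<lambda>n. fourier \<mu> (h n)) F"
    using assms by (auto simp: FT_def)
  show ?thesis
    using L2_lim_norm[OF h(3)] L2_lim_norm[OF h(2)]
    by (simp add: l2norm_fourier[OF h(1)] LIMSEQ_unique)
qed

text \<open>The isometry applied to the difference. One direction makes the transform well defined
  on classes, the other makes it injective.\<close>

lemma FT_AE_eq_iff: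
  assumes "FT f F" "FT g G"
  shows "(AE x in \<mu>. f x = g x) \<longleftrightarrow> (AE x in \<nu>. F x = G x)"
  using FT_isometry[OF FT_diff[OF assms]]
    l2norm_eq_0_iff[OF FT_L2_fun(1)[OF FT_diff[OF assms]]]
    l2norm_eq_0_iff[OF FT_L2_fun(2)[OF FT_diff[OF assms]]] by simp

text \<open>Membership of \<open>g\<close> and \<open>G\<close> is assumed separately because a
  function almost everywhere equal to a measurable one need not be measurable.\<close>

lemma FT_cong:
  assumes "FT f F" "g \<in> L2_fun \<mu>" "AE x in \<mu>. f x = g x" "G \<in> L2_fun \<nu>" "AE x in \<nu>. F x = G x"
  shows "FT g G"
  using assms L2_lim_cong unfolding FT_def by metis

text \<open>By the isometry the preimages \<open>f n\<close> converge as well. Their limit has some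
  transform \<open>G'\<close>, which is also a limit of \<open>F n\<close> and hence agrees with
  \<open>G\<close> almost everywhere.\<close>

lemma FT_range_closed:
  assumes "\<And>n. FT (f n) (F n)" "L2_lim \<nu> F G"
  shows "\<exists>g. FT g G"
proof -
  have f: "f n \<in> L2_fun \<mu>" for n by (rule FT_L2_fun(1)[OF assms(1)])
  have iso: "l2norm \<mu> (\<lambda>x. f m x - f n x) = l2norm \<nu> (\<lambda>x. F m x - F n x)" for m n
    using FT_isometry[OF FT_diff[OF assms(1) assms(1)]] by simp
  obtain g where g: "L2_lim \<mu> f g"
    using L2_lim_isometric[OF assms(2) f iso] by blast
  obtain G' where G': "FT g G'"
    using FT_exists[OF L2_limD(2)[OF g]] by blast
  have "l2norm \<nu> (\<lambda>x. F n x - G' x) = l2norm \<mu> (\<lambda>x. f n x - g x)" for n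
    using FT_isometry[OF FT_diff[OF assms(1) G']] .
  then have "L2_lim \<nu> F G'"
    using g FT_L2_fun[OF assms(1)] FT_L2_fun[OF G'] by (simp add: L2_lim_def)
  then have "AE x in \<nu>. G' x = G x"
    by (rule L2_lim_unique[OF _ assms(2)])
  then have "FT g G"
    by (intro FT_cong[OF G'] L2_limD(2)[OF assms(2)] L2_limD(2)[OF g]) auto
  then show ?thesis by blast
qed

text \<open>The combined character \<open>ch (\<delta> - \<gamma>) (- s)\<close> splits at
  \<open>s = t + (s - t)\<close> into a constant and a shifted factor, and Haar invariance removes
  the shift. The right side is modulation by \<open>- t\<close> followed by translation by
  \<open>\<gamma>\<close>, which is \<open>\<pi>_op \<nu> \<circ> \<iota>\<close>.\<close>

lemma fourier_time_frequency_shift: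
  assumes "integrable \<mu> f"
  shows "fourier \<mu> (\<lambda>s. ch \<gamma> s * f (s - t)) \<delta> = ch (\<delta> - \<gamma>) (- t) * fourier \<mu> f (\<delta> - \<gamma>)"
proof -
  have *: "ch \<gamma> s * cnj (ch \<delta> s) = ch (\<delta> - \<gamma>) (- t) * cnj (ch (\<delta> - \<gamma>) (s - t))" for s
  proof -
    have "ch (\<delta> - \<gamma>) (- t) * cnj (ch (\<delta> - \<gamma>) (s - t)) = ch (\<delta> - \<gamma>) (- s)"
      unfolding ch_uminus[symmetric] ch_add[symmetric] by simp
    then show ?thesis by (simp add: ch_uminus ch_diff_apply mult.commute)
  qed
  have "fourier \<mu> (\<lambda>s. ch \<gamma> s * f (s - t)) \<delta> =
      (LINT s|\<mu>. ch (\<delta> - \<gamma>) (- t) * (f (s - t) * cnj (ch (\<delta> - \<gamma>) (s - t))))"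
    unfolding fourier_def
    by (rule Bochner_Integration.integral_cong) (use * in \<open>simp_all add: mult_ac\<close>)
  also have "\<dots> = ch (\<delta> - \<gamma>) (- t) * (LINT s|\<mu>. f (s - t) * cnj (ch (\<delta> - \<gamma>) (s - t)))"
    by simp
  also have "(LINT s|\<mu>. f (s - t) * cnj (ch (\<delta> - \<gamma>) (s - t))) = fourier \<mu> f (\<delta> - \<gamma>)"
    unfolding fourier_def
    by (rule integral_shift[OF haar]) (intro borel_measurable_integrable integrable_mult_ch assms)
  finally show ?thesis .
qed

text \<open>The operators on both sides preserve \<open>l2norm\<close>, so the identity on the
  approximating functions survives the limit.\<close>

lemma FT_time_frequency_shift:
  assumes "FT f F"
  shows "FT (\<lambda>s. ch \<gamma> s * f (s - t)) (\<lambda>\<delta>. ch (\<delta> - \<gamma>) (- t) * F (\<delta> - \<gamma>))"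
proof -
  obtain h where h: "\<And>n. h n \<in> L1_L2_fun \<mu>" "L2_lim \<mu> h f" "L2_lim \<nu> (\<lambda>n. fourier \<mu> (h n)) F"
    using assms by (auto simp: FT_def)
  have int: "integrable \<mu> (h n)" and L2: "h n \<in> L2_fun \<mu>" for n
    using h(1)[of n] by (auto simp: L1_L2_fun_def)
  have ch: "(\<lambda>\<delta>. ch (\<delta> - \<gamma>) (- t)) \<in> borel_measurable \<nu>"
    using measurable_compose[OF haar_distr_shift(2)[OF haar_dual] measurable_ch_eval[OF haar_dual]] .
  show ?thesis
    unfolding FT_def
  proof (intro exI conjI allI)
    fix n
    have "integrable \<mu> (\<lambda>s. h n (s - t) * cnj (ch (- \<gamma>) s))"
      by (intro integrable_mult_ch integrable_shift haar int)
    then have "integrable \<mu> (\<lambda>s. ch \<gamma> s * h n (s - t))"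
      by (simp add: ch_uminus_apply mult.commute)
    then show "(\<lambda>s. ch \<gamma> s * h n (s - t)) \<in> L1_L2_fun \<mu>"
      by (simp add: L1_L2_fun_def L2_modulate_fun L2_translate_fun haar L2)
  next
    show "L2_lim \<mu> (\<lambda>n s. ch \<gamma> s * h n (s - t)) (\<lambda>s. ch \<gamma> s * f (s - t))"
      by (rule time_frequency_shift_L2_lim[OF haar measurable_ch[OF haar] norm_ch h(2)])
    have "fourier \<mu> (\<lambda>s. ch \<gamma> s * h n (s - t)) =
        (\<lambda>\<delta>. ch (\<delta> - \<gamma>) (- t) * fourier \<mu> (h n) (\<delta> - \<gamma>))" for n
      by (rule ext) (rule fourier_time_frequency_shift[OF int])
    then show "L2_lim \<nu> (\<lambda>n. fourier \<mu> (\<lambda>s. ch \<gamma> s * h n (s - t)))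
        (\<lambda>\<delta>. ch (\<delta> - \<gamma>) (- t) * F (\<delta> - \<gamma>))"
      using time_frequency_shift_L2_lim[OF haar_dual ch norm_ch h(3)] by simp
  qed
qed

section \<open>Multipliers of the range\<close>

lemma space_dual: "space \<nu> = UNIV"
  using haar_dual sets_eq_imp_space_eq[of \<nu> borel] by (simp add: haar_measure_def)

lemma sets_dual: "sets \<nu> = sets borel"
  using haar_dual by (simp add: haar_measure_def)

definition multiplier :: "('a pdual \<Rightarrow> complex) \<Rightarrow> bool" where
  "multiplier u \<longleftrightarrow> u \<in> borel_measurable \<nu> \<and> (\<exists>C. \<forall>\<delta>. cmod (u \<delta>) \<le> C) \<and>
     (\<forall>f F. FT f F \<longrightarrow> (\<exists>g. FT g (\<lambda>\<delta>. u \<delta> * F \<delta>)))"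

lemma multiplier_const: "multiplier (\<lambda>_. c)"
  unfolding multiplier_def
proof (intro conjI allI impI)
  show "\<exists>g. FT g (\<lambda>\<delta>. c * F \<delta>)" if "FT f F" for f F
    using FT_cmult[OF that, of c] by blast
qed auto

lemma multiplier_add:
  assumes "multiplier u" "multiplier v"
  shows "multiplier (\<lambda>\<delta>. u \<delta> + v \<delta>)"
  unfolding multiplier_def
proof (intro conjI allI impI)
  show "(\<lambda>\<delta>. u \<delta> + v \<delta>) \<in> borel_measurable \<nu>"
    using assms by (auto simp: multiplier_def)
  obtain C D where "\<And>\<delta>. cmod (u \<delta>) \<le> C" "\<And>\<delta>. cmod (v \<delta>) \<le> D"
    using assms by (auto simp: multiplier_def)
  then show "\<exists>C. \<forall>\<delta>. cmod (u \<delta> + v \<delta>) \<le> C"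
    by (intro exI[of _ "C + D"] allI order_trans[OF norm_triangle_ineq] add_mono)
  fix f F assume "FT f F"
  with assms obtain g h where "FT g (\<lambda>\<delta>. u \<delta> * F \<delta>)" "FT h (\<lambda>\<delta>. v \<delta> * F \<delta>)"
    unfolding multiplier_def by blast
  from FT_add[OF this] show "\<exists>g. FT g (\<lambda>\<delta>. (u \<delta> + v \<delta>) * F \<delta>)"
    by (auto simp: distrib_right)
qed

lemma multiplier_mult:
  assumes "multiplier u" "multiplier v"
  shows "multiplier (\<lambda>\<delta>. u \<delta> * v \<delta>)"
  unfolding multiplier_def
proof (intro conjI allI impI)
  show "(\<lambda>\<delta>. u \<delta> * v \<delta>) \<in> borel_measurable \<nu>"
    using assms by (auto simp: multiplier_def)
  obtain C D where CD: "\<And>\<delta>. cmod (u \<delta>) \<le> C" "\<And>\<delta>. cmod (v \<delta>) \<le> D"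
    using assms by (auto simp: multiplier_def)
  have "0 \<le> C" using norm_ge_zero CD(1) by (rule order_trans)
  then show "\<exists>C. \<forall>\<delta>. cmod (u \<delta> * v \<delta>) \<le> C"
    using CD by (intro exI[of _ "C * D"] allI) (simp add: norm_mult mult_mono)
  fix f F assume "FT f F"
  then obtain g where "FT g (\<lambda>\<delta>. v \<delta> * F \<delta>)"
    using assms(2) unfolding multiplier_def by blast
  then obtain h where "FT h (\<lambda>\<delta>. u \<delta> * (v \<delta> * F \<delta>))"
    using assms(1) unfolding multiplier_def by blast
  then show "\<exists>g. FT g (\<lambda>\<delta>. u \<delta> * v \<delta> * F \<delta>)"
    by (auto simp: mult.assoc)
qed

lemma multiplier_power: "multiplier u \<Longrightarrow> multiplier (\<lambda>\<delta>. u \<delta> ^ n)"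
  by (induction n) (auto intro: multiplier_const multiplier_mult)

lemma multiplier_sum: "finite I \<Longrightarrow> (\<And>i. i \<in> I \<Longrightarrow> multiplier (u i)) \<Longrightarrow> multiplier (\<lambda>\<delta>. \<Sum>i\<in>I. u i \<delta>)"
  by (induction I rule: finite_induct) (auto intro: multiplier_const multiplier_add)

text \<open>The products are dominated by \<open>C * cmod (F \<delta>)\<close>, so they converge in
  norm, and the range is closed.\<close>

lemma multiplier_limit:
  assumes u: "\<And>n. multiplier (u n)" and bound: "\<And>n \<delta>. cmod (u n \<delta>) \<le> C"
    and lim: "\<And>\<delta>. (\<lambda>n::nat. u n \<delta>) \<longlonglongrightarrow> v \<delta>"
  shows "multiplier v"
  unfolding multiplier_def
proof (intro conjI allI impI)
  have meas: "u n \<in> borel_measurable \<nu>" for n using u by (simp add: multiplier_def)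
  show "v \<in> borel_measurable \<nu>"
    by (rule borel_measurable_LIMSEQ_metric[OF meas lim])
  have "cmod (v \<delta>) \<le> C" for \<delta>
    using LIMSEQ_le_const2[OF tendsto_norm[OF lim]] bound by blast
  then show "\<exists>C. \<forall>\<delta>. cmod (v \<delta>) \<le> C" by blast
  fix f F assume F: "FT f F"
  have C: "0 \<le> C" using norm_ge_zero bound by (rule order_trans)
  have "\<forall>n. \<exists>g. FT g (\<lambda>\<delta>. u n \<delta> * F \<delta>)"
    using u F by (auto simp: multiplier_def)
  then obtain g where g: "\<And>n. FT (g n) (\<lambda>\<delta>. u n \<delta> * F \<delta>)" by metis
  have CF: "(\<lambda>\<delta>. of_real C * F \<delta>) \<in> L2_fun \<nu>"
    by (intro L2_fun_cmult FT_L2_fun[OF F])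
  have le: "cmod (u n \<delta> * F \<delta>) \<le> cmod (of_real C * F \<delta>)" for n \<delta>
    using bound C by (simp add: norm_mult mult_right_mono)
  have conv: "(\<lambda>n. u n \<delta> * F \<delta>) \<longlonglongrightarrow> v \<delta> * F \<delta>" for \<delta>
    by (intro tendsto_intros lim)
  note meas' = L2_funD[OF FT_L2_fun(2)[OF g]]
  have "L2_lim \<nu> (\<lambda>n \<delta>. u n \<delta> * F \<delta>) (\<lambda>\<delta>. v \<delta> * F \<delta>)"
    unfolding L2_lim_def
    by (intro conjI allI FT_L2_fun(2)[OF g] L2_fun_dominated_limit[OF meas' CF le conv]
        L2_dominated_convergence[OF meas' CF le conv])
  from FT_range_closed[OF g this] show "\<exists>g. FT g (\<lambda>\<delta>. v \<delta> * F \<delta>)" .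
qed

lemma multiplier_ch: "multiplier (\<lambda>\<delta>. ch \<delta> t)"
  unfolding multiplier_def
proof (intro conjI allI impI)
  fix f F assume "FT f F"
  \<comment> \<open>With no modulation and translation by \<open>- t\<close>, the factor on the dual
    side is exactly \<open>ch \<delta> t\<close>.\<close>
  from FT_time_frequency_shift[OF this, of 0 "- t"]
  show "\<exists>g. FT g (\<lambda>\<delta>. ch \<delta> t * F \<delta>)" by auto
qed (auto intro: measurable_ch_eval haar_dual exI[of _ 1])

text \<open>A real-linear functional on the plane is a complex combination of \<open>z\<close> and
  \<open>cnj z\<close>, and at \<open>z = ch \<delta> t\<close> the conjugate is again a character
  value, \<open>ch \<delta> (- t)\<close>. Sums and products follow from the algebra
  structure.\<close>

lemma multiplier_real_polynomial:
  "real_polynomial_function p \<Longrightarrow> multiplier (\<lambda>\<delta>. of_real (p (ch \<delta> t)))"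
proof (induction p rule: real_polynomial_function.induct)
  case (linear f)
  then interpret bounded_linear f .
  have *: "of_real (f z) = (of_real (f 1) - \<i> * of_real (f \<i>)) / 2 * z +
      (of_real (f 1) + \<i> * of_real (f \<i>)) / 2 * cnj z" for z
  proof -
    have "f z = f (Re z *\<^sub>R 1 + Im z *\<^sub>R \<i>)"
      by (rule arg_cong[where f = f]) (simp add: complex_eq_iff)
    also have "\<dots> = Re z * f 1 + Im z * f \<i>" by (simp add: add scaleR)
    finally show ?thesis by (simp add: complex_eq_iff field_simps)
  qed
  have eq: "(\<lambda>\<delta>. of_real (f (ch \<delta> t))) = (\<lambda>\<delta>. (of_real (f 1) - \<i> * of_real (f \<i>)) / 2 * ch \<delta> t +
      (of_real (f 1) + \<i> * of_real (f \<i>)) / 2 * ch \<delta> (- t))"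
    unfolding ch_uminus by (rule ext) (rule *)
  show ?case
    unfolding eq by (intro multiplier_add multiplier_mult multiplier_const multiplier_ch)
qed (auto intro: multiplier_const multiplier_add multiplier_mult)

text \<open>Approximation takes place on the circle containing all values
  \<open>ch \<delta> t\<close>, so it is automatically uniform in \<open>\<delta>\<close>.\<close>

lemma multiplier_continuous:
  fixes \<phi> :: "complex \<Rightarrow> real"
  assumes \<phi>: "continuous_on (sphere 0 1) \<phi>"
  shows "multiplier (\<lambda>\<delta>. of_real (\<phi> (ch \<delta> t)))"
proof -
  have "\<exists>p. real_polynomial_function p \<and> (\<forall>z\<in>sphere 0 1. \<bar>\<phi> z - p z\<bar> < 1 / real (Suc n))" for n
    by (rule Stone_Weierstrass_real_polynomial_function[OF compact_sphere \<phi>, of "1 / real (Suc n)"]) auto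
  then obtain p where p: "\<And>n. real_polynomial_function (p n)"
    "\<And>n z. z \<in> sphere 0 1 \<Longrightarrow> \<bar>\<phi> z - p n z\<bar> < 1 / real (Suc n)" by metis
  have "bounded (\<phi> ` sphere 0 1)"
    by (intro compact_imp_bounded compact_continuous_image \<phi> compact_sphere)
  then obtain B where B: "\<And>z. z \<in> sphere 0 1 \<Longrightarrow> \<bar>\<phi> z\<bar> \<le> B"
    unfolding bounded_iff by (metis imageI real_norm_def)
  show ?thesis
  proof (rule multiplier_limit)
    show "multiplier (\<lambda>\<delta>. of_real (p n (ch \<delta> t)))" for n
      by (rule multiplier_real_polynomial[OF p(1)])
    have c: "ch \<delta> t \<in> sphere 0 1" for \<delta> by simp
    \<comment> \<open>The approximation error \<open>1 / real (Suc n)\<close> never exceeds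
      1.\<close>
    show "cmod (of_real (p n (ch \<delta> t))) \<le> B + 1" for n \<delta>
    proof -
      have "1 / real (Suc n) \<le> 1" by simp
      with p(2)[OF c, of \<delta> n] B[OF c, of \<delta>] show ?thesis unfolding norm_of_real by linarith
    qed
    show "(\<lambda>n. complex_of_real (p n (ch \<delta> t))) \<longlonglongrightarrow> of_real (\<phi> (ch \<delta> t))" for \<delta>
    proof (intro tendsto_of_real)
      have "(\<lambda>n. p n (ch \<delta> t) - \<phi> (ch \<delta> t)) \<longlonglongrightarrow> 0"
      proof (rule Lim_null_comparison)
        show "\<forall>\<^sub>F n in sequentially. norm (p n (ch \<delta> t) - \<phi> (ch \<delta> t)) \<le> 1 / real (Suc n)"
          using p(2)[OF c, of \<delta>] by (intro always_eventually allI) (simp add: abs_minus_commute less_imp_le)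
        show "(\<lambda>n. 1 / real (Suc n)) \<longlonglongrightarrow> 0"
          by (rule lim_1_over_n[THEN LIMSEQ_Suc])
      qed
      then show "(\<lambda>n. p n (ch \<delta> t)) \<longlonglongrightarrow> \<phi> (ch \<delta> t)" by (rule LIM_zero_cancel)
    qed
  qed
qed

definition multiplier_set :: "'a pdual set \<Rightarrow> bool" where
  "multiplier_set A \<longleftrightarrow> multiplier (indicator A)"

lemma multiplier_set_Int: "multiplier_set A \<Longrightarrow> multiplier_set B \<Longrightarrow> multiplier_set (A \<inter> B)"
  unfolding multiplier_set_def indicator_inter_arith[abs_def] by (rule multiplier_mult)

lemma multiplier_set_Compl:
  assumes "multiplier_set A"
  shows "multiplier_set (- A)"
proof -
  have "indicator (- A) = (\<lambda>\<delta>. 1 + (- 1) * indicator A \<delta> :: complex)"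
    by (auto simp: fun_eq_iff indicator_def)
  with assms show ?thesis
    unfolding multiplier_set_def
    by (simp only:) (intro multiplier_add multiplier_mult multiplier_const)
qed

lemma multiplier_set_empty: "multiplier_set {}"
  using multiplier_const[of 0] by (simp add: multiplier_set_def indicator_def[abs_def])

lemma multiplier_set_Un: "multiplier_set A \<Longrightarrow> multiplier_set B \<Longrightarrow> multiplier_set (A \<union> B)"
  using multiplier_set_Compl[OF multiplier_set_Int[OF multiplier_set_Compl multiplier_set_Compl], of A B]
  by simp

lemma multiplier_set_UN_nat:
  assumes "\<And>n::nat. multiplier_set (A n)"
  shows "multiplier_set (\<Union>n. A n)"
  unfolding multiplier_set_def
proof (rule multiplier_limit)
  have "multiplier_set (\<Union>i<n. A i)" for n
    by (induction n) (auto simp: lessThan_Suc multiplier_set_empty intro: multiplier_set_Un assms)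
  then show "multiplier (indicator (\<Union>i<n. A i))" for n
    by (simp add: multiplier_set_def)
  show "cmod (indicator (\<Union>i<n. A i) \<delta>) \<le> 1" for n \<delta>
    by (simp add: indicator_def)
qed (rule LIMSEQ_indicator_UN)

lemma multiplier_set_UN:
  assumes "countable I" "\<And>i. i \<in> I \<Longrightarrow> multiplier_set (A i)"
  shows "multiplier_set (\<Union>i\<in>I. A i)"
proof (cases "I = {}")
  case False
  then have "(\<Union>i\<in>I. A i) = (\<Union>n. A (from_nat_into I n))"
    using range_from_nat_into[OF False assms(1)] by (metis image_image)
  then show ?thesis
    using multiplier_set_UN_nat[of "\<lambda>n. A (from_nat_into I n)"] assms(2) from_nat_into[OF False] by simp
qed (simp add: multiplier_set_empty)

lemma multiplier_set_INT:
  assumes "countable I" "\<And>i. i \<in> I \<Longrightarrow> multiplier_set (A i)"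
  shows "multiplier_set (\<Inter>i\<in>I. A i)"
  using multiplier_set_Compl[OF multiplier_set_UN[OF assms(1) multiplier_set_Compl[OF assms(2)]]]
  by simp

lemma multiplier_set_ch_closed:
  assumes "closed K"
  shows "multiplier_set {\<delta>. ch \<delta> t \<in> K}"
\<comment> \<open>By convention \<open>infdist\<close> to the empty set is 0, which would make the
  function below constantly 1.\<close>
proof (cases "K = {}")
  case False
  \<comment> \<open>\<open>\<phi>\<close> equals \<open>1\<close> on \<open>K\<close> and is smaller elsewhere, so its powers tend to the indicator of \<open>K\<close>.\<close>
  define \<phi> where "\<phi> z = 1 / (1 + infdist z K)" for z
  have pos: "0 < 1 + infdist z K" for z
    using infdist_nonneg[of z K] by linarith
  have \<phi>: "0 \<le> \<phi> z" "\<phi> z \<le> 1" for z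
    using infdist_nonneg[of z K] by (auto simp: \<phi>_def)
  have cont: "continuous_on (sphere 0 1) \<phi>"
    unfolding \<phi>_def using pos by (intro continuous_intros) (auto simp: less_le)
  show ?thesis
    unfolding multiplier_set_def
  proof (rule multiplier_limit)
    show "multiplier (\<lambda>\<delta>. of_real (\<phi> (ch \<delta> t)) ^ n)" for n
      by (intro multiplier_power multiplier_continuous cont)
    show "cmod (of_real (\<phi> (ch \<delta> t)) ^ n) \<le> 1" for n \<delta>
      using \<phi>[of "ch \<delta> t"] by (simp add: norm_power power_le_one)
    show "(\<lambda>n. complex_of_real (\<phi> (ch \<delta> t)) ^ n) \<longlonglongrightarrow> indicator {\<delta>. ch \<delta> t \<in> K} \<delta>" for \<delta>
    proof (cases "ch \<delta> t \<in> K")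
      case True
      then show ?thesis by (simp add: \<phi>_def)
    next
      case False
      then have "0 < infdist (ch \<delta> t) K"
        using in_closed_iff_infdist_zero[OF assms \<open>K \<noteq> {}\<close>, of "ch \<delta> t"] infdist_nonneg[of "ch \<delta> t" K]
        by linarith
      then have "\<phi> (ch \<delta> t) < 1" by (simp add: \<phi>_def)
      with \<phi>(1)[of "ch \<delta> t"] False show ?thesis
        by (simp add: LIMSEQ_power_zero)
    qed
  qed
qed (simp add: multiplier_set_empty)

lemma multiplier_set_cell:
  assumes "open B" "closed K"
  shows "multiplier_set {\<delta>. ch \<delta> ` B \<subseteq> K}"
proof -
  obtain D :: "'a set" where D: "countable D" "\<And>X. open X \<Longrightarrow> X \<noteq> {} \<Longrightarrow> \<exists>d\<in>D. d \<in> X"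
    by (erule countable_dense_setE)
  have "{\<delta>. ch \<delta> ` B \<subseteq> K} = (\<Inter>s\<in>B \<inter> D. {\<delta>. ch \<delta> s \<in> K})"
  proof (intro equalityI subsetI)
    fix \<delta> assume \<delta>: "\<delta> \<in> (\<Inter>s\<in>B \<inter> D. {\<delta>. ch \<delta> s \<in> K})"
    \<comment> \<open>The points of \<open>B\<close> violating the condition form an open set; if
      there were any, one would lie in the dense set \<open>D\<close>.\<close>
    have "open (B \<inter> ch \<delta> -` (- K))"
      using assms continuous_on_ch[of UNIV \<delta>] by (intro open_Int open_vimage open_Compl)
    with D(2) \<delta> have "B \<inter> ch \<delta> -` (- K) = {}" by fastforce
    then show "\<delta> \<in> {\<delta>. ch \<delta> ` B \<subseteq> K}" by auto
  qed auto
  moreover have "countable (B \<inter> D)" using D(1) by auto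
  ultimately show ?thesis
    using multiplier_set_INT[of "B \<inter> D"] multiplier_set_ch_closed[OF assms(2)] by simp
qed

text \<open>An open set is the union of the network cells inside it, and there are only countably
  many of them. Second countability of the group enters here through the network.\<close>

lemma multiplier_set_open:
  assumes "open U"
  shows "multiplier_set U"
proof -
  obtain \<C> :: "'a pdual set set" where \<C>: "countable \<C>"
    "\<And>C. C \<in> \<C> \<Longrightarrow> \<exists>\<F>. finite \<F> \<and> (\<forall>(B, K)\<in>\<F>. open B \<and> closed K) \<and>
          C = (\<Inter>(B, K)\<in>\<F>. {\<delta>. ch \<delta> ` B \<subseteq> K})"
    "\<And>U \<gamma>. open U \<Longrightarrow> \<gamma> \<in> U \<Longrightarrow> \<exists>C\<in>\<C>. \<gamma> \<in> C \<and> C \<subseteq> U"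
    by (rule pdual_countable_network) blast
  have "multiplier_set C" if "C \<in> \<C>" for C
  proof -
    obtain \<F> where \<F>: "finite \<F>" "\<And>B K. (B, K) \<in> \<F> \<Longrightarrow> open B \<and> closed K"
      "C = (\<Inter>(B, K)\<in>\<F>. {\<delta>. ch \<delta> ` B \<subseteq> K})"
      using \<C>(2)[OF \<open>C \<in> \<C>\<close>] by auto
    show ?thesis
      unfolding \<F>(3)
      by (rule multiplier_set_INT) (use \<F> in \<open>auto intro: countable_finite multiplier_set_cell\<close>)
  qed
  moreover have "U = \<Union>{C\<in>\<C>. C \<subseteq> U}"
    using \<C>(3)[OF assms] by blast
  moreover have "countable {C\<in>\<C>. C \<subseteq> U}"
    using \<C>(1) by (rule countable_subset[rotated]) auto
  ultimately show ?thesis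
    using multiplier_set_UN[of "{C\<in>\<C>. C \<subseteq> U}" "\<lambda>C. C"] by simp
qed

lemma multiplier_set_borel:
  assumes "A \<in> sets \<nu>"
  shows "multiplier_set A"
proof -
  have "A \<in> sigma_sets UNIV {S. open S}"
    using assms by (simp add: sets_dual borel_def)
  then show ?thesis
    by induction
      (auto intro: multiplier_set_open multiplier_set_empty multiplier_set_UN_nat
        multiplier_set_Compl simp flip: Compl_eq_Diff_UNIV)
qed

lemma multiplier_bounded_measurable:
  assumes u: "u \<in> borel_measurable \<nu>" and C: "\<And>\<delta>. cmod (u \<delta>) \<le> C"
  shows "multiplier u"
proof -
  from borel_measurable_implies_sequence_metric[OF u, of 0]
  obtain s where s: "\<And>i. simple_function \<nu> (s i)" "\<And>\<delta>. (\<lambda>i. s i \<delta>) \<longlonglongrightarrow> u \<delta>"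
    "\<And>i \<delta>. cmod (s i \<delta>) \<le> 2 * cmod (u \<delta>)"
    by (auto simp: space_dual)
  show ?thesis
  proof (rule multiplier_limit[OF _ _ s(2)])
    fix i
    have fin: "finite (range (s i))" and meas: "s i -` {y} \<in> sets \<nu>" for y
      using s(1)[of i] simple_functionD[OF s(1)[of i]] by (auto simp: space_dual)
    have "s i = (\<lambda>\<delta>. \<Sum>y\<in>range (s i). y * indicator (s i -` {y}) \<delta>)"
      using fin by (auto simp: fun_eq_iff indicator_def sum.delta' if_distrib cong: if_cong)
    moreover have "multiplier (\<lambda>\<delta>. \<Sum>y\<in>range (s i). y * indicator (s i -` {y}) \<delta>)"
      using multiplier_set_borel[OF meas] fin
      by (intro multiplier_sum multiplier_mult multiplier_const) (auto simp: multiplier_set_def)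
    ultimately show "multiplier (s i)" by simp
    \<comment> \<open>The factor 2 is inherited from the simple approximation, whose values are
      bounded by twice the distance of \<open>u \<delta>\<close> from the base point 0.\<close>
    show "cmod (s i \<delta>) \<le> 2 * C" for \<delta>
      using s(3)[of i \<delta>] C[of \<delta>] by linarith
  qed
qed

section \<open>Surjectivity\<close>

lemma multiplier_FT: "multiplier u \<Longrightarrow> FT f F \<Longrightarrow> \<exists>g. FT g (\<lambda>\<delta>. u \<delta> * F \<delta>)"
  by (auto simp: multiplier_def)

text \<open>Division by \<open>F\<close>: the quotient \<open>h / F\<close>, truncated to be
  bounded, is a multiplier, and multiplying \<open>F\<close> by it gives \<open>h\<close> on ever
  larger parts of the support of \<open>F\<close>.\<close>

lemma FT_range_support:
  assumes F: "FT f F" and h: "h \<in> L2_fun \<nu>"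
  shows "\<exists>g. FT g (\<lambda>\<delta>. indicator {\<delta>. F \<delta> \<noteq> 0} \<delta> * h \<delta>)"
proof -
  have [measurable]: "F \<in> borel_measurable \<nu>" "h \<in> borel_measurable \<nu>"
    using FT_L2_fun[OF F] h by (auto dest: L2_funD)
  \<comment> \<open>The two conditions bound the quotient by \<open>real n * real n\<close>; every
    point with \<open>F \<delta> \<noteq> 0\<close> satisfies both for large
    \<open>n\<close>.\<close>
  define u where "u n \<delta> = (if 1 \<le> real n * cmod (F \<delta>) \<and> cmod (h \<delta>) \<le> real n then h \<delta> / F \<delta> else 0)" for n \<delta>
  have "multiplier (u n)" for n
  proof (rule multiplier_bounded_measurable)
    show "u n \<in> borel_measurable \<nu>" unfolding u_def by measurable
    show "cmod (u n \<delta>) \<le> real n * real n" for \<delta>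
    proof (cases "1 \<le> real n * cmod (F \<delta>) \<and> cmod (h \<delta>) \<le> real n")
      case True
      then have "F \<delta> \<noteq> 0" by auto
      have "cmod (h \<delta>) * 1 \<le> real n * (real n * cmod (F \<delta>))"
        using True by (intro mult_mono) auto
      with True \<open>F \<delta> \<noteq> 0\<close> show ?thesis by (simp add: u_def norm_divide divide_le_eq mult.assoc)
    qed (auto simp: u_def)
  qed
  then have "\<forall>n. \<exists>g. FT g (\<lambda>\<delta>. u n \<delta> * F \<delta>)"
    using multiplier_FT[OF _ F] by blast
  then obtain g where g: "\<And>n. FT (g n) (\<lambda>\<delta>. u n \<delta> * F \<delta>)" by metis
  have le: "cmod (u n \<delta> * F \<delta>) \<le> cmod (h \<delta>)" for n \<delta>
    by (auto simp: u_def)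
  have conv: "(\<lambda>n. u n \<delta> * F \<delta>) \<longlonglongrightarrow> indicator {\<delta>. F \<delta> \<noteq> 0} \<delta> * h \<delta>" for \<delta>
  proof (cases "F \<delta> = 0")
    case False
    obtain N where N: "1 < real N * cmod (F \<delta>)"
      using ex_less_of_nat_mult[of "cmod (F \<delta>)" 1] False by auto
    obtain L where L: "cmod (h \<delta>) \<le> real L" using real_arch_simple by blast
    have "u n \<delta> * F \<delta> = h \<delta>" if "n \<ge> max N L" for n
    proof -
      have "real N * cmod (F \<delta>) \<le> real n * cmod (F \<delta>)" "real L \<le> real n"
        using that by (auto intro: mult_right_mono)
      with N L have "1 \<le> real n * cmod (F \<delta>)" "cmod (h \<delta>) \<le> real n" by linarith+
      with False show ?thesis by (simp add: u_def)
    qed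
    then have "\<forall>\<^sub>F n in sequentially. u n \<delta> * F \<delta> = h \<delta>"
      unfolding eventually_sequentially by blast
    with False show ?thesis by (simp add: tendsto_eventually)
  qed (simp add: u_def)
  note meas = L2_funD[OF FT_L2_fun(2)[OF g]]
  have "L2_lim \<nu> (\<lambda>n \<delta>. u n \<delta> * F \<delta>) (\<lambda>\<delta>. indicator {\<delta>. F \<delta> \<noteq> 0} \<delta> * h \<delta>)"
    unfolding L2_lim_def
    by (intro conjI allI FT_L2_fun(2)[OF g] L2_fun_dominated_limit[OF meas h le conv]
        L2_dominated_convergence[OF meas h le conv])
  from FT_range_closed[OF g this] show ?thesis .
qed

section \<open>Transforms without a common zero\<close>

lemma compact_pos_finite:
  obtains K where "compact K" "K \<in> sets \<mu>" "0 < measure \<mu> K" "emeasure \<mu> K < \<infinity>"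
proof -
  \<comment> \<open>The whole group is open, so inner regularity applies to it.\<close>
  have "emeasure \<mu> UNIV = (SUP K\<in>{K. compact K \<and> K \<subseteq> UNIV}. emeasure \<mu> K)" "emeasure \<mu> UNIV \<noteq> 0"
    using haar unfolding haar_measure_def by auto
  then have "0 < (SUP K\<in>{K. compact K \<and> K \<subseteq> UNIV}. emeasure \<mu> K)"
    by (simp add: zero_less_iff_neq_zero)
  then obtain K where K: "compact K" "0 < emeasure \<mu> K"
    by (auto simp: less_SUP_iff)
  have fin: "emeasure \<mu> K < \<infinity>" using haar K(1) by (auto simp: haar_measure_def)
  show thesis
  proof (rule that[OF K(1) _ _ fin])
    \<comment> \<open>Positivity gives measurability, as \<open>emeasure\<close> is 0 outside
      \<open>sets \<mu>\<close>.\<close>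
    show "K \<in> sets \<mu>" using K(2) emeasure_notin_sets by fastforce
    show "0 < measure \<mu> K" using K(2) fin by (simp add: measure_def enn2real_positive_iff)
  qed
qed

text \<open>If it vanished, integrating \<open>1 - ch \<gamma> s * cnj (ch \<delta> s)\<close> over
  \<open>K\<close> would give the full measure of \<open>K\<close>, although this function has
  modulus below 1/2 on \<open>K\<close>. The constant only has to be less than 1.\<close>

lemma fourier_modulated_indicator_nonzero:
  assumes K: "K \<in> sets \<mu>" "0 < measure \<mu> K" "emeasure \<mu> K < \<infinity>"
    and close: "\<And>s. s \<in> K \<Longrightarrow> dist (ch \<delta> s) (ch \<gamma> s) < 1/2"
  shows "fourier \<mu> (\<lambda>s. indicator K s * ch \<gamma> s) \<delta> \<noteq> 0"
proof
  assume 0: "fourier \<mu> (\<lambda>s. indicator K s * ch \<gamma> s) \<delta> = 0"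
  have ind: "integrable \<mu> (indicator K :: 'a \<Rightarrow> real)" "integrable \<mu> (indicator K :: 'a \<Rightarrow> complex)"
    using K integrable_complex_indicator by simp_all
  have int: "integrable \<mu> (\<lambda>s. indicator K s * ch \<gamma> s * cnj (ch \<delta> s))"
    using integrable_mult_ch[OF ind(2), of "\<delta> - \<gamma>"] by (simp add: ch_diff_apply mult_ac)
  have "norm (LINT s|\<mu>. indicator K s - indicator K s * ch \<gamma> s * cnj (ch \<delta> s)) \<le>
      (LINT s|\<mu>. 1/2 * indicator K s)"
  proof (rule order_trans[OF integral_norm_bound integral_mono])
    fix s
    have "1 - ch \<gamma> s * cnj (ch \<delta> s) = (ch \<delta> s - ch \<gamma> s) * cnj (ch \<delta> s)"
      by (simp add: left_diff_distrib)
    then have "cmod (1 - ch \<gamma> s * cnj (ch \<delta> s)) = dist (ch \<delta> s) (ch \<gamma> s)"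
      by (simp add: norm_mult dist_norm)
    then show "norm (indicator K s - indicator K s * ch \<gamma> s * cnj (ch \<delta> s)) \<le> 1/2 * indicator K s"
      using close[of s] by (auto simp: indicator_def)
  qed (use ind int in auto)
  also have "(LINT s|\<mu>. indicator K s - indicator K s * ch \<gamma> s * cnj (ch \<delta> s)) = of_real (measure \<mu> K)"
    using 0 K Bochner_Integration.integral_diff[OF ind(2) int] integral_complex_indicator[OF K(1)]
    by (simp add: fourier_def)
  finally show False using K by simp
qed

lemma FT_no_common_zero:
  obtains F where "\<And>n::nat. \<exists>f. FT f (F n)" "\<And>\<delta>. \<exists>n. F n \<delta> \<noteq> 0"
proof -
  obtain K where K: "compact K" "K \<in> sets \<mu>" "0 < measure \<mu> K" "emeasure \<mu> K < \<infinity>"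
    by (rule compact_pos_finite)
  define f where "f \<gamma> = (\<lambda>s. indicator K s * ch \<gamma> s :: complex)" for \<gamma>
  have "integrable \<mu> (f \<gamma>)" for \<gamma>
    using integrable_mult_ch[OF integrable_complex_indicator[OF K(2,4)], of "- \<gamma>"] by (simp add: ch_uminus_apply f_def)
  moreover have "f \<gamma> \<in> L2_fun \<mu>" for \<gamma>
  proof -
    have "(\<lambda>s. (cmod (f \<gamma> s))\<^sup>2) = indicator K"
      by (auto simp: f_def norm_mult indicator_def)
    moreover have "f \<gamma> \<in> borel_measurable \<mu>"
      unfolding f_def using K(2) haar by (intro borel_measurable_times measurable_ch) auto
    ultimately show ?thesis using K by (simp add: L2_fun_def)
  qed
  ultimately have f: "FT (f \<gamma>) (fourier \<mu> (f \<gamma>))" for \<gamma>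
    by (intro FT_fourier) (simp add: L1_L2_fun_def)
  obtain \<C> :: "'a pdual set set" where \<C>: "countable \<C>"
    "\<And>U \<gamma>. open U \<Longrightarrow> \<gamma> \<in> U \<Longrightarrow> \<exists>C\<in>\<C>. \<gamma> \<in> C \<and> C \<subseteq> U"
    by (rule pdual_countable_network) blast
  \<comment> \<open>Cells on which one single transform has no zero. Choosing one
    \<open>\<gamma>\<close> for each cell replaces the family of all characters by a
    sequence.\<close>
  define \<D> where "\<D> = {C \<in> \<C>. \<exists>\<gamma>. \<forall>\<delta>\<in>C. fourier \<mu> (f \<gamma>) \<delta> \<noteq> 0}"
  have cover: "\<exists>C\<in>\<D>. \<gamma> \<in> C" for \<gamma>
  proof -
    obtain U where U: "open U" "\<gamma> \<in> U" "\<And>\<delta>. \<delta> \<in> U \<Longrightarrow> \<forall>s\<in>K. dist (ch \<delta> s) (ch \<gamma> s) < 1/2"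
      using eventually_nhds_pdual[OF K(1), of "1/2" \<gamma>] unfolding eventually_nhds by auto
    then obtain C where C: "C \<in> \<C>" "\<gamma> \<in> C" "C \<subseteq> U" using \<C>(2) by blast
    then have "\<forall>\<delta>\<in>C. fourier \<mu> (f \<gamma>) \<delta> \<noteq> 0"
      unfolding f_def using fourier_modulated_indicator_nonzero[OF K(2-4)] U(3) by blast
    with C show ?thesis by (auto simp: \<D>_def)
  qed
  have cnt: "countable \<D>"
    using \<C>(1) by (rule countable_subset[rotated]) (auto simp: \<D>_def)
  have "\<exists>\<gamma>. \<forall>\<delta>\<in>C. fourier \<mu> (f \<gamma>) \<delta> \<noteq> 0" if "C \<in> \<D>" for C
    using that by (simp add: \<D>_def)
  then obtain c where c: "\<And>C \<delta>. C \<in> \<D> \<Longrightarrow> \<delta> \<in> C \<Longrightarrow> fourier \<mu> (f (c C)) \<delta> \<noteq> 0"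
    by metis
  show thesis
  proof (rule that[of "\<lambda>n. fourier \<mu> (f (c (from_nat_into \<D> n)))"])
    show "\<exists>g. FT g (fourier \<mu> (f (c (from_nat_into \<D> n))))" for n using f by blast
    show "\<exists>n. fourier \<mu> (f (c (from_nat_into \<D> n))) \<delta> \<noteq> 0" for \<delta>
    proof -
      obtain C where C: "C \<in> \<D>" "\<delta> \<in> C" using cover by blast
      obtain n where "from_nat_into \<D> n = C"
        using from_nat_into_surj[OF cnt C(1)] by blast
      with c[OF C] show ?thesis by blast
    qed
  qed
qed

lemma FT_surj:
  assumes h: "h \<in> L2_fun \<nu>"
  shows "\<exists>f. FT f h"
proof -
  obtain F where F: "\<And>n::nat. \<exists>f. FT f (F n)" "\<And>\<delta>. \<exists>n. F n \<delta> \<noteq> 0"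
    by (rule FT_no_common_zero) blast
  define A where "A n = {\<delta>. F n \<delta> \<noteq> 0}" for n
  have Fm: "F n \<in> borel_measurable \<nu>" for n using F(1)[of n] FT_L2_fun(2) L2_funD by blast
  have Am: "A n \<in> sets \<nu>" for n
  proof -
    have "{x \<in> space \<nu>. F n x \<noteq> 0} \<in> sets \<nu>" using Fm by measurable
    then show ?thesis by (simp add: A_def space_dual)
  qed
  have "\<forall>n. \<exists>g. FT g (\<lambda>\<delta>. indicator (\<Union>i<n. A i) \<delta> * h \<delta>)"
  proof
    fix n
    show "\<exists>g. FT g (\<lambda>\<delta>. indicator (\<Union>i<n. A i) \<delta> * h \<delta>)"
    proof (induction n)
      case 0
      \<comment> \<open>The zero function is a transform, obtained by scaling a known one by
        0.\<close>
      obtain f where "FT f (F 0)" using F(1) by blast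
      from FT_cmult[OF this, of 0] show ?case by (auto simp: indicator_def)
    next
      case (Suc n)
      obtain f where "FT f (F n)" using F(1) by blast
      then obtain g where "FT g (\<lambda>\<delta>. indicator (A n) \<delta> * h \<delta>)"
        unfolding A_def using FT_range_support[OF _ h] by blast
      \<comment> \<open>Cutting the new piece down to the part not yet covered makes the two
        summands disjoint, so that they add up to the next union.\<close>
      moreover have "multiplier_set (- (\<Union>i<n. A i))"
        using Am by (intro multiplier_set_Compl multiplier_set_UN multiplier_set_borel) auto
      ultimately obtain g' where "FT g' (\<lambda>\<delta>. indicator (- (\<Union>i<n. A i)) \<delta> * (indicator (A n) \<delta> * h \<delta>))"
        using multiplier_FT unfolding multiplier_set_def by blast
      moreover obtain k where "FT k (\<lambda>\<delta>. indicator (\<Union>i<n. A i) \<delta> * h \<delta>)"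
        using Suc.IH by blast
      ultimately have "FT (\<lambda>x. k x + g' x) (\<lambda>\<delta>. indicator (\<Union>i<n. A i) \<delta> * h \<delta> +
          indicator (- (\<Union>i<n. A i)) \<delta> * (indicator (A n) \<delta> * h \<delta>))"
        by (intro FT_add)
      moreover have "indicator (\<Union>i<n. A i) \<delta> * h \<delta> +
          indicator (- (\<Union>i<n. A i)) \<delta> * (indicator (A n) \<delta> * h \<delta>) =
          indicator (\<Union>i<Suc n. A i) \<delta> * h \<delta>" for \<delta>
        by (auto simp: indicator_def less_Suc_eq)
      ultimately show ?case by auto
    qed
  qed
  then obtain g where g: "\<And>n. FT (g n) (\<lambda>\<delta>. indicator (\<Union>i<n. A i) \<delta> * h \<delta>)" by metis
  have le: "cmod (indicator (\<Union>i<n. A i) \<delta> * h \<delta>) \<le> cmod (h \<delta>)" for n \<delta>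
    by (simp add: indicator_def)
  have "(\<Union>n. A n) = UNIV" using F(2) by (auto simp: A_def)
  then have conv: "(\<lambda>n. indicator (\<Union>i<n. A i) \<delta> * h \<delta>) \<longlonglongrightarrow> h \<delta>" for \<delta>
    using tendsto_mult[OF LIMSEQ_indicator_UN[of A \<delta>] tendsto_const[of "h \<delta>"]] by simp
  note meas = L2_funD[OF FT_L2_fun(2)[OF g]]
  have "L2_lim \<nu> (\<lambda>n \<delta>. indicator (\<Union>i<n. A i) \<delta> * h \<delta>) h"
    unfolding L2_lim_def
    by (intro conjI allI h FT_L2_fun(2)[OF g] L2_dominated_convergence[OF meas h le conv])
  from FT_range_closed[OF g this] show ?thesis .
qed

end

section \<open>Passage to classes\<close>

lemma L2_class_eq_iff:
  assumes "f \<in> L2_fun M"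
  shows "L2_class M f = L2_class M g \<longleftrightarrow> (AE x in M. f x = g x)"
  using L2_class_cong[of f g M] L2_classI[OF assms] by (auto simp: L2_class_def)

lemma L2_add_class:
  assumes "f \<in> L2_fun M" "g \<in> L2_fun M"
  shows "L2_add M (L2_class M f) (L2_class M g) = L2_class M (\<lambda>x. f x + g x)"
proof -
  have "L2_class M (\<lambda>x. f' x + g' x) = L2_class M (\<lambda>x. f x + g x)"
    if "f' \<in> L2_class M f" "g' \<in> L2_class M g" for f' g'
    by (rule L2_class_cong) (use that in \<open>auto simp: L2_class_def\<close>)
  with L2_classI[OF assms(1)] L2_classI[OF assms(2)] show ?thesis
    unfolding L2_add_def by blast
qed

text \<open>All representatives give the same integral, so the union in \<open>L2_inner\<close> is a
  singleton and \<open>the_elem\<close> is meaningful.\<close>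

lemma L2_inner_class:
  assumes "f \<in> L2_fun M" "g \<in> L2_fun M"
  shows "L2_inner M (L2_class M f) (L2_class M g) = (LINT x|M. f x * cnj (g x))"
proof -
  have "(LINT x|M. f' x * cnj (g' x)) = (LINT x|M. f x * cnj (g x))"
    if "f' \<in> L2_class M f" "g' \<in> L2_class M g" for f' g'
  proof (rule integral_cong_AE)
    show "AE x in M. f' x * cnj (g' x) = f x * cnj (g x)"
      using that by (auto simp: L2_class_def)
    show "(\<lambda>x. f' x * cnj (g' x)) \<in> borel_measurable M" "(\<lambda>x. f x * cnj (g x)) \<in> borel_measurable M"
      using that assms by (auto simp: L2_class_def intro!: borel_measurable_integrable L2_fun_integrable_mult_cnj)
  qed
  with L2_classI[OF assms(1)] L2_classI[OF assms(2)]
  have "(\<Union>f'\<in>L2_class M f. \<Union>g'\<in>L2_class M g. {LINT x|M. f' x * cnj (g' x)}) =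
      {LINT x|M. f x * cnj (g x)}" by blast
  then show ?thesis by (simp add: L2_inner_def)
qed

lemma L2_dist_class:
  assumes f: "f \<in> L2_fun M" and g: "g \<in> L2_fun M"
  shows "L2_dist M (L2_class M f) (L2_class M g) = l2norm M (\<lambda>x. f x - g x)"
proof -
  have "L2_dist M (L2_class M f) (L2_class M g) = L2_norm M (L2_class M (\<lambda>x. f x - g x))"
    unfolding L2_dist_def L2_scale_class[OF g] L2_add_class[OF f L2_fun_cmult[OF g]] by simp
  also have "\<dots> = l2norm M (\<lambda>x. f x - g x)"
    unfolding L2_norm_def L2_inner_class[OF L2_fun_diff[OF f g] L2_fun_diff[OF f g]] l2norm_def
    by (simp only: complex_norm_square[symmetric] integral_complex_of_real Re_complex_of_real)
  finally show ?thesis .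
qed

text \<open>Recovers inner products from norms, which are all that the Plancherel identity controls.
  The sign before \<open>\<i>\<close> reflects conjugate-linearity in \<open>b\<close>.\<close>

lemma polarization:
  fixes a b :: complex
  shows "4 * (a * cnj b) = of_real ((cmod (a + b))\<^sup>2) - of_real ((cmod (a - b))\<^sup>2) +
    \<i> * (of_real ((cmod (a + \<i> * b))\<^sup>2) - of_real ((cmod (a - \<i> * b))\<^sup>2))"
  by (simp only: complex_norm_square) (simp add: algebra_simps)

lemma L2_inner_polarization:
  assumes f: "f \<in> L2_fun M" and g: "g \<in> L2_fun M"
  shows "4 * (LINT x|M. f x * cnj (g x)) =
    of_real ((l2norm M (\<lambda>x. f x + g x))\<^sup>2) - of_real ((l2norm M (\<lambda>x. f x - g x))\<^sup>2) +
    \<i> * (of_real ((l2norm M (\<lambda>x. f x + \<i> * g x))\<^sup>2) - of_real ((l2norm M (\<lambda>x. f x - \<i> * g x))\<^sup>2))"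
proof -
  note ints = L2_fun_integrable[OF L2_fun_add[OF f g]] L2_fun_integrable[OF L2_fun_diff[OF f g]]
    L2_fun_integrable[OF L2_fun_add[OF f L2_fun_cmult[OF g]]]
    L2_fun_integrable[OF L2_fun_diff[OF f L2_fun_cmult[OF g]]]
  have "4 * (LINT x|M. f x * cnj (g x)) = (LINT x|M. 4 * (f x * cnj (g x)))"
    by simp
  also have "\<dots> = (LINT x|M. of_real ((cmod (f x + g x))\<^sup>2) - of_real ((cmod (f x - g x))\<^sup>2) +
    \<i> * (of_real ((cmod (f x + \<i> * g x))\<^sup>2) - of_real ((cmod (f x - \<i> * g x))\<^sup>2)))"
    unfolding polarization ..
  also have "\<dots> = of_real ((l2norm M (\<lambda>x. f x + g x))\<^sup>2) - of_real ((l2norm M (\<lambda>x. f x - g x))\<^sup>2) +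
    \<i> * (of_real ((l2norm M (\<lambda>x. f x + \<i> * g x))\<^sup>2) - of_real ((l2norm M (\<lambda>x. f x - \<i> * g x))\<^sup>2))"
    unfolding l2norm_square using ints by (simp del: of_real_power)
  finally show ?thesis .
qed

context plancherel_pair
begin

text \<open>For classes of square-integrable functions the property under \<open>THE\<close> is just
  \<open>FT f G\<close>. Uniqueness is \<open>FT_AE_eq_iff\<close> with the same \<open>f\<close> on
  both sides.\<close>

lemma L2_fourier_class:
  assumes F: "FT f F"
  shows "L2_fourier \<mu> \<nu> (L2_class \<mu> f) = L2_class \<nu> F"
proof -
  have FT_iff: "(\<exists>h. (\<forall>n. h n \<in> L1_L2_fun \<mu>) \<and>
        (\<lambda>n. L2_dist \<mu> (L2_class \<mu> (h n)) (L2_class \<mu> f)) \<longlonglongrightarrow> 0 \<and>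
        (\<lambda>n. L2_dist \<nu> (L2_class \<nu> (fourier \<mu> (h n))) (L2_class \<nu> G)) \<longlonglongrightarrow> 0) \<longleftrightarrow> FT f G"
    if G: "G \<in> L2_fun \<nu>" for G
  proof -
    have "(\<lambda>n. L2_dist \<mu> (L2_class \<mu> (h n)) (L2_class \<mu> f)) \<longlonglongrightarrow> 0 \<and>
        (\<lambda>n. L2_dist \<nu> (L2_class \<nu> (fourier \<mu> (h n))) (L2_class \<nu> G)) \<longlonglongrightarrow> 0 \<longleftrightarrow>
        L2_lim \<mu> h f \<and> L2_lim \<nu> (\<lambda>n. fourier \<mu> (h n)) G"
      if h: "\<forall>n. h n \<in> L1_L2_fun \<mu>" for h
    proof -
      have h': "h n \<in> L2_fun \<mu>" "fourier \<mu> (h n) \<in> L2_fun \<nu>" for n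
        using h fourier_L2_fun by (auto simp: L1_L2_fun_def)
      show ?thesis
        by (simp add: L2_lim_def h' G FT_L2_fun[OF F] L2_dist_class)
    qed
    then show ?thesis unfolding FT_def by blast
  qed
  show ?thesis
    unfolding L2_fourier_def
  proof (rule the_equality)
    show "L2_class \<nu> F \<in> L2 \<nu> \<and> (\<exists>h. (\<forall>n. h n \<in> L1_L2_fun \<mu>) \<and>
        (\<lambda>n. L2_dist \<mu> (L2_class \<mu> (h n)) (L2_class \<mu> f)) \<longlonglongrightarrow> 0 \<and>
        (\<lambda>n. L2_dist \<nu> (L2_class \<nu> (fourier \<mu> (h n))) (L2_class \<nu> F)) \<longlonglongrightarrow> 0)"
      using FT_iff[OF FT_L2_fun(2)[OF F]] F FT_L2_fun(2)[OF F] by (simp add: L2_def)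
  next
    fix Y assume Y: "Y \<in> L2 \<nu> \<and> (\<exists>h. (\<forall>n. h n \<in> L1_L2_fun \<mu>) \<and>
        (\<lambda>n. L2_dist \<mu> (L2_class \<mu> (h n)) (L2_class \<mu> f)) \<longlonglongrightarrow> 0 \<and>
        (\<lambda>n. L2_dist \<nu> (L2_class \<nu> (fourier \<mu> (h n))) Y) \<longlonglongrightarrow> 0)"
    then obtain G where G: "G \<in> L2_fun \<nu>" "Y = L2_class \<nu> G" by (auto simp: L2_def)
    with Y have "FT f G" using FT_iff[OF G(1)] by simp
    from FT_AE_eq_iff[OF this F] show "Y = L2_class \<nu> F"
      unfolding G(2) by (intro L2_class_cong) simp
  qed
qed

lemma L2_fourier_classE:
  assumes "X \<in> L2 \<mu>"
  obtains f F where "X = L2_class \<mu> f" "FT f F" "L2_fourier \<mu> \<nu> X = L2_class \<nu> F"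
proof -
  obtain f where f: "X = L2_class \<mu> f" "f \<in> L2_fun \<mu>" using assms by (auto simp: L2_def)
  obtain F where F: "FT f F" using FT_exists[OF f(2)] by blast
  show thesis using that[OF f(1) F] L2_fourier_class[OF F] f(1) by simp
qed

text \<open>Each of the four combinations in the polarization identity is itself a pair in
  \<open>FT\<close>, so the isometry applies to all of them.\<close>

lemma FT_inner:
  assumes "FT f F" "FT g G"
  shows "(LINT x|\<nu>. F x * cnj (G x)) = (LINT x|\<mu>. f x * cnj (g x))"
proof -
  have "4 * (LINT x|\<nu>. F x * cnj (G x)) = 4 * (LINT x|\<mu>. f x * cnj (g x))"
    unfolding L2_inner_polarization[OF FT_L2_fun(1)[OF assms(1)] FT_L2_fun(1)[OF assms(2)]]
      L2_inner_polarization[OF FT_L2_fun(2)[OF assms(1)] FT_L2_fun(2)[OF assms(2)]]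
      FT_isometry[OF FT_add[OF assms]] FT_isometry[OF FT_diff[OF assms]]
      FT_isometry[OF FT_add[OF assms(1) FT_cmult[OF assms(2)]]]
      FT_isometry[OF FT_diff[OF assms(1) FT_cmult[OF assms(2)]]] ..
  then show ?thesis by simp
qed

lemma L2_unitary_fourier: "L2_unitary \<mu> \<nu> (L2_fourier \<mu> \<nu>)"
  unfolding L2_unitary_def
proof (intro conjI ballI allI)
  show "bij_betw (L2_fourier \<mu> \<nu>) (L2 \<mu>) (L2 \<nu>)"
    unfolding bij_betw_def
  proof
    show "inj_on (L2_fourier \<mu> \<nu>) (L2 \<mu>)"
    proof (rule inj_onI)
      fix X Y assume XY: "X \<in> L2 \<mu>" "Y \<in> L2 \<mu>" and eq: "L2_fourier \<mu> \<nu> X = L2_fourier \<mu> \<nu> Y"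
      obtain f F where f: "X = L2_class \<mu> f" "FT f F" "L2_fourier \<mu> \<nu> X = L2_class \<nu> F"
        using XY(1) by (rule L2_fourier_classE)
      obtain g G where g: "Y = L2_class \<mu> g" "FT g G" "L2_fourier \<mu> \<nu> Y = L2_class \<nu> G"
        using XY(2) by (rule L2_fourier_classE)
      have "L2_class \<nu> F = L2_class \<nu> G" using eq f(3) g(3) by simp
      then show "X = Y"
        unfolding f(1) g(1) L2_class_eq_iff[OF FT_L2_fun(1)[OF f(2)]]
          L2_class_eq_iff[OF FT_L2_fun(2)[OF f(2)]] FT_AE_eq_iff[OF f(2) g(2)] .
    qed
    show "L2_fourier \<mu> \<nu> ` L2 \<mu> = L2 \<nu>"
    proof (intro equalityI subsetI)
      fix Y assume "Y \<in> L2_fourier \<mu> \<nu> ` L2 \<mu>"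
      then obtain X where X: "X \<in> L2 \<mu>" "Y = L2_fourier \<mu> \<nu> X" by blast
      obtain f F where "X = L2_class \<mu> f" "FT f F" "L2_fourier \<mu> \<nu> X = L2_class \<nu> F"
        using X(1) by (rule L2_fourier_classE)
      then show "Y \<in> L2 \<nu>" using X(2) FT_L2_fun(2) by (auto simp: L2_def)
    next
      fix Y assume "Y \<in> L2 \<nu>"
      then obtain G where G: "G \<in> L2_fun \<nu>" "Y = L2_class \<nu> G" by (auto simp: L2_def)
      then obtain g where g: "FT g G" using FT_surj by blast
      then have "Y = L2_fourier \<mu> \<nu> (L2_class \<mu> g)" using G L2_fourier_class by simp
      moreover have "L2_class \<mu> g \<in> L2 \<mu>" using FT_L2_fun(1)[OF g] by (simp add: L2_def)
      ultimately show "Y \<in> L2_fourier \<mu> \<nu> ` L2 \<mu>" by blast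
    qed
  qed
next
  fix X Y assume XY: "X \<in> L2 \<mu>" "Y \<in> L2 \<mu>"
  obtain f F where f: "X = L2_class \<mu> f" "FT f F" "L2_fourier \<mu> \<nu> X = L2_class \<nu> F"
    using XY(1) by (rule L2_fourier_classE)
  obtain g G where g: "Y = L2_class \<mu> g" "FT g G" "L2_fourier \<mu> \<nu> Y = L2_class \<nu> G"
    using XY(2) by (rule L2_fourier_classE)
  note L2 = FT_L2_fun[OF f(2)] FT_L2_fun[OF g(2)]
  show "L2_fourier \<mu> \<nu> (L2_add \<mu> X Y) = L2_add \<nu> (L2_fourier \<mu> \<nu> X) (L2_fourier \<mu> \<nu> Y)"
    using L2_fourier_class[OF FT_add[OF f(2) g(2)]]
    by (simp only: f(3) g(3) L2_add_class L2) (simp only: f(1) g(1) L2_add_class L2)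
  show "L2_inner \<nu> (L2_fourier \<mu> \<nu> X) (L2_fourier \<mu> \<nu> Y) = L2_inner \<mu> X Y"
    unfolding f(3) g(3) using FT_inner[OF f(2) g(2)] by (simp add: f(1) g(1) L2_inner_class L2)
next
  fix c X assume X: "X \<in> L2 \<mu>"
  obtain f F where f: "X = L2_class \<mu> f" "FT f F" "L2_fourier \<mu> \<nu> X = L2_class \<nu> F"
    using X by (rule L2_fourier_classE)
  show "L2_fourier \<mu> \<nu> (L2_scale \<mu> c X) = L2_scale \<nu> c (L2_fourier \<mu> \<nu> X)"
    unfolding f(3) using L2_fourier_class[OF FT_cmult[OF f(2), of c]]
    by (simp add: f(1) L2_scale_class FT_L2_fun[OF f(2)])
qed

lemma L2_fourier_in_L2: "X \<in> L2 \<mu> \<Longrightarrow> L2_fourier \<mu> \<nu> X \<in> L2 \<nu>"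
  using L2_unitary_fourier unfolding L2_unitary_def by (blast dest: bij_betwE)

lemma L2_fourier_intertwines:
  assumes "X \<in> L2 \<mu>"
  shows "L2_fourier \<mu> \<nu> (\<pi> \<mu> g X) = (\<pi>_op \<nu> \<circ> \<iota>) g (L2_fourier \<mu> \<nu> X)"
proof -
  obtain \<gamma> t where g: "g = (\<gamma>, t)" by force
  obtain f F where f: "X = L2_class \<mu> f" "FT f F" "L2_fourier \<mu> \<nu> X = L2_class \<nu> F"
    using assms by (rule L2_fourier_classE)
  have "\<pi> \<mu> g X = L2_class \<mu> (\<lambda>s. ch \<gamma> s * f (s - t))"
    unfolding f(1) g by (rule \<pi>_class[OF haar FT_L2_fun(1)[OF f(2)]])
  moreover have "(\<pi>_op \<nu> \<circ> \<iota>) g (L2_fourier \<mu> \<nu> X) =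
      L2_class \<nu> (\<lambda>\<delta>. ch (\<delta> - \<gamma>) (- t) * F (\<delta> - \<gamma>))"
    unfolding f(3) g using \<pi>_op_class[OF haar_dual FT_L2_fun(2)[OF f(2)]] by (simp add: \<iota>_def)
  ultimately show ?thesis
    using L2_fourier_class[OF FT_time_frequency_shift[OF f(2)]] by simp
qed

end

lemma \<pi>_in_L2:
  assumes "haar_measure \<mu>" "X \<in> L2 \<mu>"
  shows "\<pi> \<mu> g X \<in> L2 \<mu>"
proof -
  obtain f where f: "X = L2_class \<mu> f" "f \<in> L2_fun \<mu>" using assms(2) by (auto simp: L2_def)
  obtain \<gamma> t where g: "g = (\<gamma>, t)" by force
  have "(\<lambda>s. ch \<gamma> s * f (s - t)) \<in> L2_fun \<mu>"
    using assms(1) f(2) by (intro L2_modulate_fun L2_translate_fun) auto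
  then show ?thesis
    unfolding f(1) g \<pi>_class[OF assms(1) f(2)] by (simp add: L2_def)
qed

text \<open>Translation and modulation commute up to a scalar: \<open>ch (\<delta> - \<gamma>) (- t)
  = ch \<gamma> t * ch \<delta> (- t)\<close>. The factor \<open>ch \<gamma> t\<close> is the one
  that \<open>r_map\<close> puts on the circle component.\<close>

lemma lift_\<pi>_op_\<iota>_eq_lift_\<pi>':
  assumes \<nu>: "haar_measure \<nu>" and Y: "Y \<in> L2 \<nu>"
  shows "lift_rep \<nu> (\<pi>_op \<nu> \<circ> \<iota>) (g, z) Y = lift_rep \<nu> (\<pi>' \<nu>) (r_map (g, z)) Y"
proof -
  obtain F where F: "Y = L2_class \<nu> F" "F \<in> L2_fun \<nu>" using Y by (auto simp: L2_def)
  obtain \<gamma> t where g: "g = (\<gamma>, t)" by force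
  have op: "(\<lambda>\<delta>. ch (\<delta> - \<gamma>) (- t) * F (\<delta> - \<gamma>)) \<in> L2_fun \<nu>"
    by (rule L2_translate_fun[OF \<nu> L2_modulate_fun[OF F(2) measurable_ch_eval[OF \<nu>] norm_ch]])
  have p': "(\<lambda>\<delta>. ch \<delta> (- t) * F (\<delta> - \<gamma>)) \<in> L2_fun \<nu>"
    by (intro L2_modulate_fun L2_translate_fun \<nu> F(2) measurable_ch_eval norm_ch)
  have "lift_rep \<nu> (\<pi>_op \<nu> \<circ> \<iota>) (g, z) Y = L2_class \<nu> (\<lambda>\<delta>. z * (ch (\<delta> - \<gamma>) (- t) * F (\<delta> - \<gamma>)))"
    by (simp add: lift_rep_def \<iota>_def g F(1) \<pi>_op_class[OF \<nu> F(2)] L2_scale_class[OF op])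
  also have "\<dots> = L2_class \<nu> (\<lambda>\<delta>. ch \<gamma> t * z * (ch \<delta> (- t) * F (\<delta> - \<gamma>)))"
    by (simp add: ch_diff_apply ch_uminus mult_ac)
  also have "\<dots> = lift_rep \<nu> (\<pi>' \<nu>) (r_map (g, z)) Y"
    by (simp add: lift_rep_def r_map_def g F(1) \<pi>'_class[OF \<nu> F(2)] L2_scale_class[OF p'])
  finally show ?thesis .
qed

theorem theorem1p5:
  fixes \<mu> :: "'a::{topological_ab_group_add, t2_space, second_countable_topology} measure"
    and \<nu> :: "'a pdual measure"
  assumes "locally compact (UNIV :: 'a set)"
    and "haar_measure \<mu>"
    and "plancherel_measure \<mu> \<nu>"
  shows "L2_unitary \<mu> \<nu> (L2_fourier \<mu> \<nu>) \<and>
    (\<forall>g. \<forall>X\<in>L2 \<mu>. L2_fourier \<mu> \<nu> (\<pi> \<mu> g X) = (\<pi>_op \<nu> \<circ> \<iota>) g (L2_fourier \<mu> \<nu> X)) \<and>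
    (\<forall>(g, z)\<in>carrier (twisted_product \<sigma>). \<forall>X\<in>L2 \<mu>.
      L2_fourier \<mu> \<nu> (lift_rep \<mu> (\<pi> \<mu>) (g, z) X) =
        lift_rep \<nu> (\<pi>_op \<nu> \<circ> \<iota>) (g, z) (L2_fourier \<mu> \<nu> X) \<and>
      lift_rep \<nu> (\<pi>_op \<nu> \<circ> \<iota>) (g, z) (L2_fourier \<mu> \<nu> X) =
        lift_rep \<nu> (\<pi>' \<nu>) (r_map (g, z)) (L2_fourier \<mu> \<nu> X))"
proof -
  interpret plancherel_pair \<mu> \<nu>
    using assms(2,3) by unfold_locales
  \<comment> \<open>Lifting only multiplies by \<open>z\<close>, so homogeneity reduces the lifted
    relation to the unlifted one.\<close>
  have scale: "L2_fourier \<mu> \<nu> (L2_scale \<mu> c X) = L2_scale \<nu> c (L2_fourier \<mu> \<nu> X)"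
    if "X \<in> L2 \<mu>" for c X
    using L2_unitary_fourier that by (simp add: L2_unitary_def)
  have "L2_fourier \<mu> \<nu> (lift_rep \<mu> (\<pi> \<mu>) (g, z) X) =
      lift_rep \<nu> (\<pi>_op \<nu> \<circ> \<iota>) (g, z) (L2_fourier \<mu> \<nu> X)" if "X \<in> L2 \<mu>" for g z X
    unfolding lift_rep_def prod.case
    by (simp only: scale[OF \<pi>_in_L2[OF haar that]] L2_fourier_intertwines[OF that])
  then show ?thesis
    using L2_unitary_fourier L2_fourier_intertwines
      lift_\<pi>_op_\<iota>_eq_lift_\<pi>'[OF haar_dual L2_fourier_in_L2] by blast
qed

end
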